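(* Let $\sigma>1$ be an integer, $\rho$ an integer relatively prime to $\sigma$, $\theta=2\rho\pi/\sigma$, $\omega=e^{i\theta}$, $G$ a matrix of rank $r$ with column set $E$, and $\mathbb{A}$ of order $q\ge2$, in the setting described in the context. For $k=0,\dots,\sigma-1$ let $\mathcal{M}_{1,-1}(k,\sigma)$ be the set of pairs $(f,g)$ of functions $f,g:E\to\mathbb{A}$ such that $f-g$ is a flow of $G$ over $\mathbb{A}$ and $|\mathrm{supp}(f)|-|\mathrm{supp}(g)|\equiv k\pmod\sigma$. Then, except in the three cases ($\sigma=2$, $q=4$), ($\sigma=3$, $q=3$), ($\sigma=4$, $q=2$), $$\sum_{k=0}^{\sigma-1}\omega^k|\mathcal{M}_{1,-1}(k,\sigma)| = (2-2\cos\theta)^r(2\cos\theta-2+q)^{|E|-r}\,R\!\left(M(G);\frac{q(2\cos\theta-2+q)}{2-2\cos\theta},\frac{2-2\cos\theta}{2\cos\theta-2+q}\right).$$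
   Context: $i=\sqrt{-1}$. Setting (the paper's hypothesis "$G$ is a totally-$\mathbb{P}$ matrix and $\mathbb{A}$ a $\mathbb{P}$-module of order $q$", read as the following cases): either (i) $G$ is the vertex–edge or cycle–edge matrix of a graph with edge set $E$, or a totally unimodular matrix, and $\mathbb{A}$ is an Abelian group of order $q$; or (ii) $G$ is a matrix over $\mathrm{GF}(p^s)$, $\mathbb{A}=\mathrm{GF}(p^s)^d$, $q=p^{sd}$. With $H$ a matrix orthogonally dual to $G$ (same columns, rows of $H$ orthogonal to rows of $G$, ranks summing to $|E|$; integer in case (i)), a flow of $G$ over $\mathbb{A}$ is $h:E\to\mathbb{A}$ with $Hh^T=0$ (equivalently an $\mathbb{A}$-combination of rows of $G$). $\mathrm{supp}(f)=\{e: f(e)\ne0\}$. $M(G)$ is the matroid on $E$ of linear dependence of the columns of $G$, rank function $\mathrm{rk}$, rank $r$; $R(M;\lambda,x)=\sum_{B\subseteq E}\lambda^{r-\mathrm{rk}(B)}x^{|B|-\mathrm{rk}(B)}$.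
   Formalization: In case (i), when flows are defined by Hh^T=0, the rows of the integer dual H must also generate all integer vectors orthogonal to the rows of G (otherwise e.g. G=(1,1), H=(2,-2), A=Z/2 fails); flows as A-combinations of rows of G need no such condition. *)

theory Defs
  imports
    Complex_Main
    "HOL-Library.FuncSet"
    "HOL-Number_Theory.Cong"
    "HOL-Analysis.Finite_Cartesian_Product"
    "Graph_Theory.Digraph"
    "Graph_Theory.Arc_Walk"
    "Jordan_Normal_Form.DL_Rank"
    "Jordan_Normal_Form.DL_Submatrix"
begin

text \<open>
  The column set of a matrix \<open>G\<close> is \<open>E = {..<dim_col G}\<close>. Functions on \<open>E\<close> are taken
  extensional (\<open>E \<rightarrow>\<^sub>E UNIV\<close>), so that they can be counted.
\<close>

abbreviation col_set :: "'r mat \<Rightarrow> nat set" where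
  "col_set G \<equiv> {..<dim_col G}"

abbreviation mat_rank :: "'k::field mat \<Rightarrow> nat" where
  "mat_rank G \<equiv> vec_space.rank (dim_row G) G"


section \<open>The matroid of linear dependence of the columns\<close>

text \<open>Columns are treated as an indexed family: equal columns at two positions are dependent.\<close>

definition indep_cols :: "'k::field mat \<Rightarrow> nat set \<Rightarrow> bool" where
  "indep_cols G I \<longleftrightarrow>
     (\<forall>c. (\<forall>i<dim_row G. (\<Sum>j\<in>I. c j * G $$ (i, j)) = 0) \<longrightarrow> (\<forall>j\<in>I. c j = 0))"

definition matroid_rk :: "'k::field mat \<Rightarrow> nat set \<Rightarrow> nat" where
  "matroid_rk G B = Max (card ` {I. I \<subseteq> B \<and> indep_cols G I})"

text \<open>
  The natural-number subtractions below do not truncate, as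
  \<open>rk B \<le> rk E\<close> and \<open>rk B \<le> card B\<close> for a matroid rank function.
\<close>

definition rank_gen_poly :: "'e set \<Rightarrow> ('e set \<Rightarrow> nat) \<Rightarrow> real \<Rightarrow> real \<Rightarrow> real" where
  "rank_gen_poly E rk l x = (\<Sum>B\<in>Pow E. l ^ (rk E - rk B) * x ^ (card B - rk B))"


section \<open>Integer matrices: graphs and total unimodularity\<close>

definition totally_unimodular :: "int mat \<Rightarrow> bool" where
  "totally_unimodular G \<longleftrightarrow>
     (\<forall>I J. I \<subseteq> {..<dim_row G} \<and> J \<subseteq> {..<dim_col G} \<and> card I = card J \<longrightarrow>
        det (submatrix G I J) \<in> {-1, 0, 1})"

text \<open>
  A graph (loops and parallel edges allowed) with a fixed reference orientation of its edges
  is a finite digraph. In the signed vertex-edge matrix a loop has a zero column.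
\<close>

definition vertex_edge_matrix :: "('v, 'e) pre_digraph \<Rightarrow> int mat \<Rightarrow> bool" where
  "vertex_edge_matrix D G \<longleftrightarrow>
     (\<exists>vs es. distinct vs \<and> set vs = verts D \<and> distinct es \<and> set es = arcs D \<and>
        G = mat (length vs) (length es) (\<lambda>(i, j).
              (if head D (es ! j) = vs ! i then 1 else 0)
            - (if tail D (es ! j) = vs ! i then 1 else 0)))"

text \<open>
  Walks in the underlying undirected graph are walks in the following digraph, where
  \<open>(e, True)\<close> traverses \<open>e\<close> along and \<open>(e, False)\<close> against its reference orientation.
\<close>

definition both_ways :: "('v, 'e) pre_digraph \<Rightarrow> ('v, 'e \<times> bool) pre_digraph" where
  "both_ways D = \<lparr>verts = verts D, arcs = arcs D \<times> UNIV,
     tail = (\<lambda>(e, s). if s then tail D e else head D e),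
     head = (\<lambda>(e, s). if s then head D e else tail D e)\<rparr>"

text \<open>Distinctness of the edges only excludes going along an edge and straight back.\<close>

definition graph_cycle :: "('v, 'e) pre_digraph \<Rightarrow> ('e \<times> bool) list \<Rightarrow> bool" where
  "graph_cycle D c \<longleftrightarrow> pre_digraph.cycle (both_ways D) c \<and> distinct (map fst c)"

text \<open>
  One row for each cycle of the graph. Cycles are identified with their edge sets;
  the direction in which each cycle is traversed is arbitrary.
\<close>

definition cycle_edge_matrix :: "('v, 'e) pre_digraph \<Rightarrow> int mat \<Rightarrow> bool" where
  "cycle_edge_matrix D G \<longleftrightarrow>
     (\<exists>cs es. distinct es \<and> set es = arcs D \<and>
        (\<forall>c\<in>set cs. graph_cycle D c) \<and>
        distinct (map (\<lambda>c. fst ` set c) cs) \<and>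
        (\<lambda>c. fst ` set c) ` set cs = {fst ` set c | c. graph_cycle D c} \<and>
        G = mat (length cs) (length es) (\<lambda>(i, j).
              if (es ! j, True) \<in> set (cs ! i) then 1
              else if (es ! j, False) \<in> set (cs ! i) then -1 else 0))"


section \<open>Flows\<close>

definition int_scale :: "int \<Rightarrow> 'a::ab_group_add \<Rightarrow> 'a" where
  "int_scale n a = (\<Sum>i<nat n. a) - (\<Sum>i<nat (-n). a)"

text \<open>\<open>sm\<close> is the scalar action of the ring of matrix entries on the coefficient module.\<close>

definition kernel_flows :: "('r \<Rightarrow> 'a::comm_monoid_add \<Rightarrow> 'a) \<Rightarrow> 'r mat \<Rightarrow> (nat \<Rightarrow> 'a) set" where
  "kernel_flows sm H = {h \<in> col_set H \<rightarrow>\<^sub>E UNIV.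
     \<forall>i<dim_row H. (\<Sum>j\<in>col_set H. sm (H $$ (i, j)) (h j)) = 0}"

definition row_combinations :: "('r \<Rightarrow> 'a::comm_monoid_add \<Rightarrow> 'a) \<Rightarrow> 'r mat \<Rightarrow> (nat \<Rightarrow> 'a) set" where
  "row_combinations sm G = {h \<in> col_set G \<rightarrow>\<^sub>E UNIV.
     \<exists>c. \<forall>j\<in>col_set G. h j = (\<Sum>i<dim_row G. sm (G $$ (i, j)) (c i))}"

definition orthogonally_dual :: "'k::field mat \<Rightarrow> 'k mat \<Rightarrow> bool" where
  "orthogonally_dual G H \<longleftrightarrow>
     dim_col H = dim_col G \<and>
     H * transpose_mat G = 0\<^sub>m (dim_row H) (dim_row G) \<and>
     mat_rank G + mat_rank H = dim_col G"

text \<open>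
  Over the integers, duality has to be understood integrally: the rows of \<open>H\<close> must generate
  all integer vectors orthogonal to the rows of \<open>G\<close>, and not just a subgroup of finite index.
  Otherwise \<open>2 H\<close> would also be dual to \<open>G\<close>, although every function into \<open>\<int>/2\<close> is in its kernel.
\<close>

definition int_orthogonally_dual :: "int mat \<Rightarrow> int mat \<Rightarrow> bool" where
  "int_orthogonally_dual G H \<longleftrightarrow>
     orthogonally_dual (map_mat rat_of_int G) (map_mat rat_of_int H) \<and>
     (\<forall>x \<in> carrier_vec (dim_col G). G *\<^sub>v x = 0\<^sub>v (dim_row G) \<longrightarrow>
        (\<exists>c \<in> carrier_vec (dim_row H). x = transpose_mat H *\<^sub>v c))"

text \<open>
  A flow is a function in the kernel of a dual matrix, equivalently
  a combination of the rows of \<open>G\<close> with coefficients in the module. Both descriptions are admitted.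
\<close>

definition int_flow_set :: "int mat \<Rightarrow> (nat \<Rightarrow> 'a::ab_group_add) set \<Rightarrow> bool" where
  "int_flow_set G F \<longleftrightarrow>
     (\<exists>H. int_orthogonally_dual G H \<and> F = kernel_flows int_scale H) \<or>
     F = row_combinations int_scale G"

definition field_flow_set :: "'k::field mat \<Rightarrow> (nat \<Rightarrow> 'k ^ 'd) set \<Rightarrow> bool" where
  "field_flow_set G F \<longleftrightarrow>
     (\<exists>H. orthogonally_dual G H \<and> F = kernel_flows (*s) H) \<or>
     F = row_combinations (*s) G"

definition supp :: "'e set \<Rightarrow> ('e \<Rightarrow> 'a::zero) \<Rightarrow> 'e set" where
  "supp E f = {e \<in> E. f e \<noteq> 0}"

text \<open>The set of pairs counted, for the set \<open>F\<close> of flows.\<close>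

definition pairs_M :: "'e set \<Rightarrow> ('e \<Rightarrow> 'a::ab_group_add) set \<Rightarrow> nat \<Rightarrow> nat \<Rightarrow> (('e \<Rightarrow> 'a) \<times> ('e \<Rightarrow> 'a)) set" where
  "pairs_M E F k \<sigma> = {(f, g). f \<in> E \<rightarrow>\<^sub>E UNIV \<and> g \<in> E \<rightarrow>\<^sub>E UNIV \<and>
     (\<lambda>e\<in>E. f e - g e) \<in> F \<and>
     [int (card (supp E f)) - int (card (supp E g)) = int k] (mod int \<sigma>)}"

end

theory Submission
  imports Defs
begin

text \<open>
  Summing over \<open>g\<close> for fixed \<open>h = f - g\<close> factorises over the columns: a column contributes \<open>q\<close> where
  \<open>h\<close> vanishes and \<open>t = 2 cos \<theta> - 2 + q\<close> elsewhere. Writing \<open>q = t + (2 - 2 cos \<theta>)\<close> and expanding the product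
  gives a sum over subsets \<open>B\<close> of the columns, weighted by the number of flows vanishing on \<open>B\<close>. It remains to see
  that this number is \<open>q ^ (r - rk B)\<close>. The three exceptional cases are exactly those with \<open>t = 0\<close>.

  For the count it suffices that every independent set \<open>I\<close> of columns has dual rows, that is, ring combinations
  of the rows of \<open>G\<close> whose restrictions to \<open>I\<close> are the unit vectors: a flow is then freely determined by its values
  on a basis. Over a field and for totally unimodular matrices dual rows come from inverting a minor,
  for the matrices of a graph they are fundamental cuts and cycles.
\<close>

section \<open>Dual rows and the number of flows vanishing on a set of columns\<close>

text \<open>The obstacle is torsion. A dependence of integer columns is a relation in which column
  \<open>b\<close> has some coefficient \<open>x b\<close>, and when the relation acts on elements
  of an Abelian group, \<open>x b\<close> cannot be divided out. Dual rows resolve this: applied to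
  the relation they show that every coefficient is a multiple of \<open>x b\<close>, so the
  cancellation happens among matrix entries, and columns expand over a basis with coefficients in
  the ring. Total unimodularity would be too strong as a common hypothesis: in the complete graph on
  four vertices, two 4-cycles pass a given pair of disjoint edges, one in equal and one in opposite
  relative direction, and this gives a minor 2 or -2 of the matrix of all cycles. The kernel
  description of flows is reduced to row combinations, by comparing cardinalities over a field and
  by integral duality over the integers.\<close>

definition independent_cols :: "'r::comm_ring_1 mat \<Rightarrow> nat set \<Rightarrow> bool" where
  "independent_cols G I \<longleftrightarrow>
     (\<forall>c. (\<forall>i<dim_row G. (\<Sum>j\<in>I. c j * G $$ (i, j)) = 0) \<longrightarrow> (\<forall>j\<in>I. c j = 0))"

text \<open>Entry \<open>j\<close> of the combination of the rows of \<open>G\<close> with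
  coefficients \<open>c i\<close>. If \<open>c\<close> is dual to a basis, this is the coefficient
  of column \<open>i\<close> in the expansion of column \<open>j\<close> over that basis.\<close>

definition expansion_coeff :: "'r::comm_ring_1 mat \<Rightarrow> (nat \<Rightarrow> nat \<Rightarrow> 'r) \<Rightarrow> nat \<Rightarrow> nat \<Rightarrow> 'r" where
  "expansion_coeff G c i j = (\<Sum>k<dim_row G. c i k * G $$ (k, j))"

definition dual_rows :: "'r::comm_ring_1 mat \<Rightarrow> nat set \<Rightarrow> (nat \<Rightarrow> nat \<Rightarrow> 'r) \<Rightarrow> bool" where
  "dual_rows G I c \<longleftrightarrow>
     (\<forall>i\<in>I. \<forall>j\<in>I. expansion_coeff G c i j = (if i = j then 1 else 0))"

text \<open>Over the integers the condition says that the lattice generated by the rows projects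
  onto all integer vectors indexed by an independent \<open>I\<close>. Every matrix over a field
  satisfies it.\<close>

definition unimodular_mat :: "'r::comm_ring_1 mat \<Rightarrow> bool" where
  "unimodular_mat G \<longleftrightarrow> (\<forall>I. I \<subseteq> col_set G \<longrightarrow> independent_cols G I \<longrightarrow> (\<exists>c. dual_rows G I c))"

definition basis_of_cols :: "'r::comm_ring_1 mat \<Rightarrow> nat set \<Rightarrow> nat set \<Rightarrow> bool" where
  "basis_of_cols G B I \<longleftrightarrow> I \<subseteq> B \<and> independent_cols G I \<and>
     (\<forall>b\<in>B - I. \<not> independent_cols G (insert b I))"

definition col_rk :: "'r::comm_ring_1 mat \<Rightarrow> nat set \<Rightarrow> nat" where
  "col_rk G B = Max (card ` {I. I \<subseteq> B \<and> independent_cols G I})"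

section \<open>Independent sets of columns, bases and coordinates\<close>

lemma independent_cols_empty [simp]: "independent_cols G {}"
  by (simp add: independent_cols_def)

lemma independent_cols_subset:
  assumes "independent_cols G I" "J \<subseteq> I" "finite I"
  shows "independent_cols G J"
  unfolding independent_cols_def
proof (intro allI impI)
  fix c assume c: "\<forall>i<dim_row G. (\<Sum>j\<in>J. c j * G $$ (i, j)) = 0"
  define d where "d j = (if j \<in> J then c j else 0)" for j
  have "(\<Sum>j\<in>I. d j * G $$ (i, j)) = (\<Sum>j\<in>J. c j * G $$ (i, j))" for i
    using assms(2,3) by (intro sum.mono_neutral_cong_right) (auto simp: d_def)
  then have "\<forall>j\<in>I. d j = 0"
    using assms(1) c unfolding independent_cols_def by auto
  then show "\<forall>j\<in>J. c j = 0"
    using assms(2) by (auto simp: d_def split: if_splits)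
qed

lemma independent_colsD:
  assumes "independent_cols G I" "\<And>i. i < dim_row G \<Longrightarrow> (\<Sum>j\<in>I. c j * G $$ (i, j)) = 0" "j \<in> I"
  shows "c j = 0"
  using spec[OF assms(1)[unfolded independent_cols_def], of c] assms(2,3) by simp

lemma dual_rows_subset: "dual_rows G I c \<Longrightarrow> J \<subseteq> I \<Longrightarrow> dual_rows G J c"
  unfolding dual_rows_def by blast

lemma unimodular_matI:
  assumes "\<And>I i. I \<subseteq> col_set G \<Longrightarrow> independent_cols G I \<Longrightarrow> i \<in> I \<Longrightarrow>
    \<exists>c. \<forall>j\<in>I. (\<Sum>k<dim_row G. c k * G $$ (k, j)) = (if i = j then 1 else 0)"
  shows "unimodular_mat G"
  unfolding unimodular_mat_def dual_rows_def expansion_coeff_def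
proof (intro allI impI)
  fix I assume "I \<subseteq> col_set G" "independent_cols G I"
  then have "\<forall>i\<in>I. \<exists>c. \<forall>j\<in>I. (\<Sum>k<dim_row G. c k * G $$ (k, j)) = (if i = j then 1 else 0)"
    using assms by simp
  then show "\<exists>c. \<forall>i\<in>I. \<forall>j\<in>I. (\<Sum>k<dim_row G. c i k * G $$ (k, j)) = (if i = j then 1 else 0)"
    by (rule bchoice)
qed

lemma unimodular_mat_basisE:
  assumes "unimodular_mat G" "basis_of_cols G (col_set G) I"
  obtains c where "dual_rows G I c"
proof -
  have "\<exists>c. dual_rows G I c"
    using assms unfolding unimodular_mat_def basis_of_cols_def by simp
  then show ?thesis
    by (rule exE) (rule that)
qed

lemma basis_of_cols_extend:
  assumes "J \<subseteq> B" "independent_cols G J" "finite B"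
  obtains I where "J \<subseteq> I" "basis_of_cols G B I"
proof -
  let ?A = "{I. I \<subseteq> B \<and> J \<subseteq> I \<and> independent_cols G I}"
  have "finite ?A"
    using assms(3) by simp
  moreover have "?A \<noteq> {}"
    using assms(1,2) by blast
  ultimately have "\<exists>I\<in>?A. \<forall>I'\<in>?A. I \<subseteq> I' \<longrightarrow> I = I'"
    by (rule finite_has_maximal)
  then obtain I where "I \<in> ?A" and max: "\<forall>I'\<in>?A. I \<subseteq> I' \<longrightarrow> I = I'"
    by (rule bexE)
  then have I: "I \<subseteq> B" "J \<subseteq> I" "independent_cols G I"
    by simp_all
  have "\<not> independent_cols G (insert b I)" if "b \<in> B - I" for b
    using bspec[OF max, of "insert b I"] that I by auto
  with I have "basis_of_cols G B I"
    by (simp add: basis_of_cols_def)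
  with I(2) show ?thesis
    by (rule that)
qed

lemma col_rk_attained:
  assumes "finite B"
  obtains I where "basis_of_cols G B I" "card I = col_rk G B"
proof -
  let ?A = "{I. I \<subseteq> B \<and> independent_cols G I}"
  have fin: "finite (card ` ?A)"
    using assms by simp
  moreover have "card ` ?A \<noteq> {}"
    using independent_cols_empty by blast
  ultimately have "Max (card ` ?A) \<in> card ` ?A"
    by (rule Max_in)
  then obtain I where I: "I \<subseteq> B" "independent_cols G I" "card I = col_rk G B"
    by (auto simp: col_rk_def)
  have "\<not> independent_cols G (insert b I)" if "b \<in> B - I" for b
  proof
    assume "independent_cols G (insert b I)"
    with that I(1) have "insert b I \<in> ?A"
      by blast
    then have "card (insert b I) \<le> col_rk G B"
      unfolding col_rk_def using fin by (intro Max_ge) auto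
    moreover have "card (insert b I) = Suc (card I)"
      using that I(1) assms finite_subset by (metis DiffD2 card_insert_disjoint)
    ultimately show False
      using I(3) by simp
  qed
  with I show ?thesis
    by (intro that[of I]) (simp_all add: basis_of_cols_def)
qed

text \<open>The dual row of \<open>i\<close> acts as a coordinate functional: it extracts the
  coefficient of column \<open>i\<close> from a combination of columns in \<open>I\<close>, without
  division.\<close>

lemma sum_dual_rows:
  assumes "dual_rows G I c" "i \<in> I" "J \<subseteq> I" "finite J"
  shows "(\<Sum>k<dim_row G. c i k * (\<Sum>j\<in>J. x j * G $$ (k, j))) = (if i \<in> J then x i else 0)"
proof -
  have "(\<Sum>k<dim_row G. c i k * (\<Sum>j\<in>J. x j * G $$ (k, j)))
      = (\<Sum>j\<in>J. x j * expansion_coeff G c i j)"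
    unfolding expansion_coeff_def sum_distrib_left by (subst sum.swap) (simp add: mult_ac)
  also have "\<dots> = (\<Sum>j\<in>J. if j = i then x j else 0)"
    using assms(1-3) by (intro sum.cong) (auto simp: dual_rows_def)
  finally show ?thesis
    using assms(4) by simp
qed

text \<open>For \<open>b\<close> outside \<open>I\<close>, maximality of \<open>I\<close> gives a
  nontrivial relation \<open>x\<close> on \<open>insert b I\<close>, with \<open>x b\<close> nonzero
  because \<open>I\<close> is independent. The dual row of \<open>i\<close> turns it into
  \<open>x i = - (x b * expansion_coeff G c i b)\<close>. Hence \<open>x b\<close> is a common
  factor, which cancels in an integral domain.\<close>

lemma basis_of_cols_expansion:
  fixes G :: "'r::idom mat"
  assumes I: "basis_of_cols G B I" and fin: "finite B"
    and c: "dual_rows G I c" and b: "b \<in> B" and k: "k < dim_row G"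
  shows "G $$ (k, b) = (\<Sum>i\<in>I. expansion_coeff G c i b * G $$ (k, i))"
proof (cases "b \<in> I")
  case True
  have "finite I"
    using I fin finite_subset by (auto simp: basis_of_cols_def)
  have "(\<Sum>i\<in>I. expansion_coeff G c i b * G $$ (k, i))
      = (\<Sum>i\<in>I. if i = b then G $$ (k, i) else 0)"
    using c True by (intro sum.cong) (auto simp: dual_rows_def)
  then show ?thesis
    using True \<open>finite I\<close> by simp
next
  case False
  have finI: "finite I"
    using I fin finite_subset by (auto simp: basis_of_cols_def)
  have indep: "independent_cols G I"
    using I by (simp add: basis_of_cols_def)
  have "\<not> independent_cols G (insert b I)"
    using I b False by (auto simp: basis_of_cols_def)
  then obtain x where x: "\<And>k. k < dim_row G \<Longrightarrow> (\<Sum>j\<in>insert b I. x j * G $$ (k, j)) = 0"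
    and nz: "\<exists>j\<in>insert b I. x j \<noteq> 0"
    by (auto simp: independent_cols_def)
  have x': "x b * G $$ (k, b) + (\<Sum>j\<in>I. x j * G $$ (k, j)) = 0" if "k < dim_row G" for k
    using x[OF that] False finI by simp
  have xb: "x b \<noteq> 0"
  proof
    assume "x b = 0"
    with x' indep have "\<forall>j\<in>I. x j = 0"
      by (auto simp: independent_cols_def)
    with nz \<open>x b = 0\<close> show False
      by auto
  qed
  have xi: "x i = - (x b * expansion_coeff G c i b)" if "i \<in> I" for i
  proof -
    have "0 = (\<Sum>l<dim_row G. c i l * (x b * G $$ (l, b) + (\<Sum>j\<in>I. x j * G $$ (l, j))))"
      using x' by simp
    also have "\<dots> = x b * expansion_coeff G c i b + x i"
      using sum_dual_rows[OF c that order_refl finI, of x] that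
      by (simp add: expansion_coeff_def distrib_left sum.distrib sum_distrib_left mult_ac)
    finally show ?thesis
      by (metis add.commute eq_neg_iff_add_eq_0)
  qed
  have "x b * G $$ (k, b) = - (\<Sum>j\<in>I. x j * G $$ (k, j))"
    using x'[OF k] by (simp add: eq_neg_iff_add_eq_0)
  also have "\<dots> = x b * (\<Sum>i\<in>I. expansion_coeff G c i b * G $$ (k, i))"
    unfolding sum_negf[symmetric] sum_distrib_left[of "x b"]
    by (intro sum.cong) (simp_all add: xi mult_ac)
  finally show ?thesis
    using xb by simp
qed

text \<open>The two instances are the integers acting on a finite Abelian group and a finite field
  acting on a coordinate space. Only the ring of matrix entries is free of zero divisors; a nonzero
  scalar may annihilate elements of the module.\<close>

locale finite_module = Modules.module scale
  for scale :: "'r::idom \<Rightarrow> 'a::{ab_group_add, finite} \<Rightarrow> 'a"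
begin

lemma row_combinationsI:
  assumes "h \<in> col_set G \<rightarrow>\<^sub>E UNIV"
    and "\<And>j. j \<in> col_set G \<Longrightarrow> h j = (\<Sum>i\<in>I. scale (expansion_coeff G c i j) (a i))"
  shows "h \<in> row_combinations scale G"
proof -
  have "h j = (\<Sum>k<dim_row G. scale (G $$ (k, j)) (\<Sum>i\<in>I. scale (c i k) (a i)))"
    if "j \<in> col_set G" for j
  proof -
    have "h j = (\<Sum>i\<in>I. \<Sum>k<dim_row G. scale (G $$ (k, j) * c i k) (a i))"
      by (simp add: assms(2)[OF that] expansion_coeff_def scale_sum_left mult.commute)
    also have "\<dots> = (\<Sum>k<dim_row G. \<Sum>i\<in>I. scale (G $$ (k, j) * c i k) (a i))"
      by (rule sum.swap)
    finally show ?thesis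
      by (simp add: scale_sum_right)
  qed
  then show ?thesis
    using assms(1) unfolding row_combinations_def
    by (intro CollectI conjI exI[of _ "\<lambda>k. \<Sum>i\<in>I. scale (c i k) (a i)"]) simp_all
qed

text \<open>Each value of \<open>h\<close> pairs the corresponding column with one fixed family
  \<open>d\<close> of module elements, so a linear relation between columns holds for the values of
  \<open>h\<close> as well.\<close>

lemma row_combinations_expansion:
  assumes I: "basis_of_cols G B I" "B \<subseteq> col_set G"
    and c: "dual_rows G I c" and h: "h \<in> row_combinations scale G" and b: "b \<in> B"
  shows "h b = (\<Sum>i\<in>I. scale (expansion_coeff G c i b) (h i))"
proof -
  obtain d where d: "\<And>j. j < dim_col G \<Longrightarrow> h j = (\<Sum>k<dim_row G. scale (G $$ (k, j)) (d k))"
    using h by (auto simp: row_combinations_def)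
  have IE: "i < dim_col G" if "i \<in> I" for i
    using that I by (auto simp: basis_of_cols_def)
  have "h b = (\<Sum>k<dim_row G. scale (\<Sum>i\<in>I. expansion_coeff G c i b * G $$ (k, i)) (d k))"
    using d[of b] b I(2) basis_of_cols_expansion[OF I(1) _ c b] finite_subset[OF I(2)] by auto
  also have "\<dots> = (\<Sum>k<dim_row G. \<Sum>i\<in>I. scale (expansion_coeff G c i b * G $$ (k, i)) (d k))"
    by (simp add: scale_sum_left)
  also have "\<dots> = (\<Sum>i\<in>I. \<Sum>k<dim_row G. scale (expansion_coeff G c i b * G $$ (k, i)) (d k))"
    by (rule sum.swap)
  also have "\<dots> = (\<Sum>i\<in>I. scale (expansion_coeff G c i b) (h i))"
    using IE by (intro sum.cong) (simp_all add: d scale_sum_right)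
  finally show ?thesis .
qed

text \<open>The values on \<open>I\<close> determine everything and those on \<open>J\<close> are
  zero, so only the values on \<open>I - J\<close> remain. They are arbitrary: combining the dual
  rows of \<open>I - J\<close> with prescribed module elements realises them and keeps the values on
  \<open>B\<close> zero.\<close>

lemma card_row_combinations_vanishing_bases:
  assumes J: "basis_of_cols G B J" and I: "basis_of_cols G (col_set G) I" "J \<subseteq> I"
    and B: "B \<subseteq> col_set G" and c: "dual_rows G I c"
  shows "card {h \<in> row_combinations scale G. \<forall>b\<in>B. h b = 0} = CARD('a) ^ (card I - card J)"
proof -
  let ?E = "col_set G"
  let ?S = "{h \<in> row_combinations scale G. \<forall>b\<in>B. h b = 0}"
  have IE: "I \<subseteq> ?E" and JB: "J \<subseteq> B" and finI: "finite I" and finJ: "finite J"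
    using I J B finite_subset[of _ ?E] by (auto simp: basis_of_cols_def)
  have cJ: "dual_rows G J c"
    using c I(2) by (rule dual_rows_subset)
  have expand: "h j = (\<Sum>i\<in>I. scale (expansion_coeff G c i j) (h i))"
    if "h \<in> row_combinations scale G" "j \<in> ?E" for h j
    using I(1) order_refl c that by (rule row_combinations_expansion)
  have uI: "expansion_coeff G c i j = (if i = j then 1 else 0)" if "i \<in> I" "j \<in> I" for i j
    using c that by (simp add: dual_rows_def)
  \<comment> \<open>Column \<open>b\<close> is a combination of the columns in \<open>J\<close>,
    each of which is annihilated by the dual row of an \<open>i\<close> outside
    \<open>J\<close>.\<close>
  have uB: "expansion_coeff G c i b = 0" if "i \<in> I - J" "b \<in> B" for i b
  proof -
    have "expansion_coeff G c i b = (\<Sum>k<dim_row G. c i k * (\<Sum>j\<in>J. expansion_coeff G c j b * G $$ (k, j)))"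
      unfolding expansion_coeff_def[of G c i]
      using basis_of_cols_expansion[OF J finite_subset[OF B] cJ that(2)] by auto
    then show ?thesis
      using sum_dual_rows[OF c _ I(2) finJ] that by simp
  qed
  have "bij_betw (\<lambda>h. restrict h (I - J)) ?S ((I - J) \<rightarrow>\<^sub>E UNIV)"
  proof (rule bij_betw_imageI)
    show "inj_on (\<lambda>h. restrict h (I - J)) ?S"
    proof (rule inj_onI)
      fix h h' assume h: "h \<in> ?S" and h': "h' \<in> ?S"
        and eq: "restrict h (I - J) = restrict h' (I - J)"
      have "h i = h' i" if "i \<in> I" for i
      proof (cases "i \<in> J")
        case True
        then show ?thesis
          using h h' JB by auto
      next
        case False
        then show ?thesis
          using fun_cong[OF eq, of i] that by simp
      qed
      then have "h j = h' j" if "j \<in> ?E" for j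
        using expand[of h j] expand[of h' j] h h' that by simp
      then show "h = h'"
        using h h' by (intro extensionalityI[of _ ?E]) (auto simp: row_combinations_def PiE_def)
    qed
  next
    have "a \<in> (\<lambda>h. restrict h (I - J)) ` ?S" if a: "a \<in> (I - J) \<rightarrow>\<^sub>E UNIV" for a
    proof -
      define h where "h = (\<lambda>j\<in>?E. \<Sum>i\<in>I - J. scale (expansion_coeff G c i j) (a i))"
      have h: "h \<in> row_combinations scale G"
        by (rule row_combinationsI[where I = "I - J" and a = a and c = c]) (simp_all add: h_def)
      have "h b = 0" if "b \<in> B" for b
        using that B uB by (auto simp: h_def)
      have "h i = a i" if "i \<in> I - J" for i
      proof -
        have "h i = (\<Sum>l\<in>I - J. if l = i then a l else 0)"
          unfolding h_def using that IE by (auto simp: uI intro!: sum.cong)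
        then show ?thesis
          using that finI by simp
      qed
      then have "a = restrict h (I - J)"
        using a by (intro extensionalityI[of _ "I - J"]) (simp_all add: PiE_def)
      with h \<open>\<And>b. b \<in> B \<Longrightarrow> h b = 0\<close> show ?thesis
        by blast
    qed
    then show "(\<lambda>h. restrict h (I - J)) ` ?S = (I - J) \<rightarrow>\<^sub>E UNIV"
      by (intro subset_antisym image_subsetI subsetI) (simp_all add: restrict_PiE_iff)
  qed
  then have "card ?S = card ((I - J) \<rightarrow>\<^sub>E (UNIV :: 'a set))"
    by (rule bij_betw_same_card)
  then show ?thesis
    using finI finJ I(2) by (simp add: card_funcsetE card_Diff_subset)
qed

lemma card_row_combinations_basis:
  assumes "unimodular_mat G" "basis_of_cols G (col_set G) I"
  shows "card (row_combinations scale G) = CARD('a) ^ card I"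
proof -
  obtain c where c: "dual_rows G I c"
    using assms by (rule unimodular_mat_basisE)
  show ?thesis
    using card_row_combinations_vanishing_bases[of G "{}" "{}", OF _ assms(2) _ _ c]
    by (simp add: basis_of_cols_def)
qed

text \<open>All bases have the same size because each of them counts the row combinations.\<close>

lemma card_row_combinations_vanishing:
  assumes uni: "unimodular_mat G" and q: "CARD('a) \<ge> 2" and B: "B \<subseteq> col_set G"
  shows "card {h \<in> row_combinations scale G. \<forall>b\<in>B. h b = 0}
    = CARD('a) ^ (col_rk G (col_set G) - col_rk G B)"
proof -
  have finB: "finite B"
    using B finite_subset by blast
  obtain J where J: "basis_of_cols G B J" "card J = col_rk G B"
    using finB by (rule col_rk_attained)
  then have "J \<subseteq> col_set G" "independent_cols G J"
    using B by (auto simp: basis_of_cols_def)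
  then obtain I where I: "J \<subseteq> I" "basis_of_cols G (col_set G) I"
    using basis_of_cols_extend by blast
  \<comment> \<open>\<open>I\<close> has to contain \<open>J\<close>, and \<open>K\<close> has to
    attain the maximum in \<open>col_rk\<close>; nothing so far makes one basis do both.\<close>
  obtain K where K: "basis_of_cols G (col_set G) K" "card K = col_rk G (col_set G)"
    using col_rk_attained by blast
  obtain c where "dual_rows G I c"
    using uni I(2) by (rule unimodular_mat_basisE)
  then have "card {h \<in> row_combinations scale G. \<forall>b\<in>B. h b = 0} = CARD('a) ^ (card I - card J)"
    using J(1) I(2,1) B by (intro card_row_combinations_vanishing_bases)
  moreover have "CARD('a) ^ card I = CARD('a) ^ card K"
    using card_row_combinations_basis[OF uni] I(2) K(1) by metis
  then have "card I = card K"
    using q by (simp add: power_inject_exp)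
  ultimately show ?thesis
    using J(2) K(2) by simp
qed

lemma col_rk_mono:
  assumes "A \<subseteq> B" "finite B"
  shows "col_rk G A \<le> col_rk G B"
proof -
  obtain I where "basis_of_cols G A I" "card I = col_rk G A"
    using col_rk_attained[OF finite_subset[OF assms]] .
  then show ?thesis
    unfolding col_rk_def[of _ B] using assms
    by (intro Max_ge) (auto simp: basis_of_cols_def image_iff intro!: exI[of _ I])
qed

lemma row_combinations_subset_kernel_flows:
  assumes "dim_col H = dim_col G"
    and "\<And>k l. k < dim_row H \<Longrightarrow> l < dim_row G \<Longrightarrow> (\<Sum>j<dim_col G. H $$ (k, j) * G $$ (l, j)) = 0"
  shows "row_combinations scale G \<subseteq> kernel_flows scale H"
proof
  fix h assume h: "h \<in> row_combinations scale G"
  then obtain d where d: "\<And>j. j < dim_col G \<Longrightarrow> h j = (\<Sum>l<dim_row G. scale (G $$ (l, j)) (d l))"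
    by (auto simp: row_combinations_def)
  have "(\<Sum>j<dim_col G. scale (H $$ (k, j)) (h j)) = 0" if "k < dim_row H" for k
  proof -
    have "(\<Sum>j<dim_col G. scale (H $$ (k, j)) (h j))
        = (\<Sum>j<dim_col G. \<Sum>l<dim_row G. scale (H $$ (k, j) * G $$ (l, j)) (d l))"
      by (intro sum.cong) (simp_all add: d scale_sum_right)
    also have "\<dots> = (\<Sum>l<dim_row G. scale (\<Sum>j<dim_col G. H $$ (k, j) * G $$ (l, j)) (d l))"
      by (subst sum.swap) (simp add: scale_sum_left)
    finally show ?thesis
      using assms(2)[OF that] by simp
  qed
  with h show "h \<in> kernel_flows scale H"
    by (auto simp: kernel_flows_def row_combinations_def assms(1))
qed

text \<open>A kernel element is determined by its values off a basis \<open>J\<close> of the columns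
  of \<open>H\<close>: the difference of two elements that agree there satisfies relations on
  \<open>J\<close> alone, and the dual rows of \<open>J\<close> extract from them that each value on
  \<open>J\<close> is zero.\<close>

lemma card_kernel_flows_le:
  assumes uni: "unimodular_mat H"
  shows "card (kernel_flows scale H) \<le> CARD('a) ^ (dim_col H - col_rk H (col_set H))"
proof -
  let ?E = "col_set H"
  obtain J where J: "basis_of_cols H ?E J" "card J = col_rk H ?E"
    using col_rk_attained by blast
  then have JE: "J \<subseteq> ?E"
    by (auto simp: basis_of_cols_def)
  then have finJ: "finite J"
    using finite_subset by blast
  obtain c where c: "dual_rows H J c"
    using uni J(1) by (rule unimodular_mat_basisE)
  have "inj_on (\<lambda>h. restrict h (?E - J)) (kernel_flows scale H)"
  proof (rule inj_onI)
    fix h h' assume h: "h \<in> kernel_flows scale H" and h': "h' \<in> kernel_flows scale H"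
      and eq: "restrict h (?E - J) = restrict h' (?E - J)"
    define d where "d j = h j - h' j" for j
    have d0: "d j = 0" if "j \<in> ?E - J" for j
      using fun_cong[OF eq, of j] that by (simp add: d_def)
    have "(\<Sum>j\<in>J. scale (H $$ (k, j)) (d j)) = 0" if "k < dim_row H" for k
    proof -
      have "(\<Sum>j\<in>J. scale (H $$ (k, j)) (d j)) = (\<Sum>j\<in>?E. scale (H $$ (k, j)) (d j))"
        using JE d0 by (intro sum.mono_neutral_left) auto
      then show ?thesis
        using h h' that by (simp add: d_def scale_right_diff_distrib sum_subtractf kernel_flows_def)
    qed
    then have ker: "(\<Sum>k<dim_row H. scale (c i k) (\<Sum>j\<in>J. scale (H $$ (k, j)) (d j))) = 0" for i
      by simp
    have "d i = 0" if "i \<in> J" for i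
    proof -
      have "(\<Sum>k<dim_row H. scale (c i k) (\<Sum>j\<in>J. scale (H $$ (k, j)) (d j)))
          = (\<Sum>j\<in>J. scale (expansion_coeff H c i j) (d j))"
        unfolding scale_sum_right expansion_coeff_def by (subst sum.swap) (simp add: scale_sum_left)
      also have "\<dots> = (\<Sum>j\<in>J. if j = i then d j else 0)"
        using c that by (intro sum.cong) (auto simp: dual_rows_def)
      finally show ?thesis
        using ker[of i] that finJ by simp
    qed
    with d0 have "h j = h' j" if "j \<in> ?E" for j
      using that by (cases "j \<in> J") (auto simp: d_def)
    then show "h = h'"
      using h h' by (intro extensionalityI[of _ ?E]) (auto simp: kernel_flows_def PiE_def)
  qed
  then have "card (kernel_flows scale H) \<le> card ((?E - J) \<rightarrow>\<^sub>E (UNIV :: 'a set))"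
    by (rule card_inj_on_le) (simp_all add: image_subset_iff restrict_PiE_iff finite_PiE)
  also have "\<dots> = CARD('a) ^ (dim_col H - card J)"
    using JE finJ by (simp add: card_funcsetE card_Diff_subset)
  finally show ?thesis
    using J(2) by simp
qed

text \<open>Orthogonality gives one inclusion, and the rank condition makes the upper bound for the
  kernel equal to the number of row combinations. This is the route for fields, where both
  unimodularity hypotheses hold automatically.\<close>

lemma kernel_flows_eq_row_combinations_if_ranks_add:
  assumes dim: "dim_col H = dim_col G"
    and orth: "\<And>k l. k < dim_row H \<Longrightarrow> l < dim_row G \<Longrightarrow> (\<Sum>j<dim_col G. H $$ (k, j) * G $$ (l, j)) = 0"
    and rk: "col_rk G (col_set G) + col_rk H (col_set H) = dim_col G"
    and uni: "unimodular_mat G" "unimodular_mat H"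
  shows "kernel_flows scale H = row_combinations scale G"
proof -
  obtain I where I: "basis_of_cols G (col_set G) I" "card I = col_rk G (col_set G)"
    using col_rk_attained by blast
  have sub: "row_combinations scale G \<subseteq> kernel_flows scale H"
    using dim orth by (rule row_combinations_subset_kernel_flows)
  have "card (kernel_flows scale H) \<le> CARD('a) ^ (dim_col H - col_rk H (col_set H))"
    using uni(2) by (rule card_kernel_flows_le)
  also have "dim_col H - col_rk H (col_set H) = card I"
    using rk dim I(2) by simp
  also have "CARD('a) ^ card I = card (row_combinations scale G)"
    using card_row_combinations_basis[OF uni(1) I(1)] by simp
  finally have "card (kernel_flows scale H) \<le> card (row_combinations scale G)" .
  moreover have "finite (kernel_flows scale H)"
    unfolding kernel_flows_def
    by (rule finite_subset[of _ "col_set H \<rightarrow>\<^sub>E UNIV"]) (auto intro!: finite_PiE)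
  ultimately show ?thesis
    using sub card_seteq by metis
qed

text \<open>The relation that expands column \<open>j\<close> over the basis \<open>I\<close> is
  orthogonal to the rows of \<open>G\<close>, so \<open>gen\<close> writes it as a ring combination
  of the rows of \<open>H\<close>, which annihilate \<open>h\<close>. Thus \<open>h j\<close>
  expands in the same way as column \<open>j\<close>, and \<open>h\<close> is the combination of the
  dual rows with coefficients \<open>h i\<close>.\<close>

lemma kernel_flows_eq_row_combinations_if_integral:
  assumes dim: "dim_col H = dim_col G"
    and orth: "\<And>k l. k < dim_row H \<Longrightarrow> l < dim_row G \<Longrightarrow> (\<Sum>j<dim_col G. H $$ (k, j) * G $$ (l, j)) = 0"
    and gen: "\<And>x. (\<And>l. l < dim_row G \<Longrightarrow> (\<Sum>j<dim_col G. G $$ (l, j) * x j) = 0) \<Longrightarrow>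
      \<exists>d. \<forall>j<dim_col G. x j = (\<Sum>k<dim_row H. H $$ (k, j) * d k)"
    and uni: "unimodular_mat G"
  shows "kernel_flows scale H = row_combinations scale G"
proof
  let ?E = "col_set G"
  obtain I where I: "basis_of_cols G ?E I" "card I = col_rk G ?E"
    using col_rk_attained by blast
  then have IE: "I \<subseteq> ?E"
    by (auto simp: basis_of_cols_def)
  then have finI: "finite I"
    using finite_subset by blast
  obtain c where c: "dual_rows G I c"
    using uni I(1) by (rule unimodular_mat_basisE)
  show "kernel_flows scale H \<subseteq> row_combinations scale G"
  proof
    fix h assume h: "h \<in> kernel_flows scale H"
    have hu: "h j = (\<Sum>i\<in>I. scale (expansion_coeff G c i j) (h i))" if j: "j \<in> ?E" for j
    proof -
      \<comment> \<open>The unit vector at \<open>j\<close> minus the coordinates of column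
        \<open>j\<close> with respect to \<open>I\<close>.\<close>
      define x where "x l = (if l = j then 1 else 0) - (if l \<in> I then expansion_coeff G c l j else 0)" for l
      have scale_x: "(\<Sum>l<dim_col G. scale (x l) (h l)) = h j - (\<Sum>i\<in>I. scale (expansion_coeff G c i j) (h i))"
      proof -
        have "(\<Sum>l<dim_col G. scale (x l) (h l)) =
            (\<Sum>l<dim_col G. (if l = j then h l else 0) - (if l \<in> I then scale (expansion_coeff G c l j) (h l) else 0))"
          by (intro sum.cong) (auto simp: x_def scale_left_diff_distrib)
        then show ?thesis
          using j IE by (simp add: sum_subtractf sum.inter_restrict[symmetric] Int_absorb1)
      qed
      have "(\<Sum>l<dim_col G. G $$ (k, l) * x l) = 0" if "k < dim_row G" for k
      proof -
        have "(\<Sum>l<dim_col G. G $$ (k, l) * x l) = (\<Sum>l<dim_col G.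
            (if l = j then G $$ (k, l) else 0) - (if l \<in> I then expansion_coeff G c l j * G $$ (k, l) else 0))"
          by (intro sum.cong) (auto simp: x_def algebra_simps)
        also have "\<dots> = G $$ (k, j) - (\<Sum>i\<in>I. expansion_coeff G c i j * G $$ (k, i))"
          using j IE by (simp add: sum_subtractf sum.inter_restrict[symmetric] Int_absorb1)
        finally show ?thesis
          using basis_of_cols_expansion[OF I(1) _ c j that] by simp
      qed
      then obtain d where d: "\<And>l. l < dim_col G \<Longrightarrow> x l = (\<Sum>k<dim_row H. H $$ (k, l) * d k)"
        using gen by blast
      have "(\<Sum>l<dim_col G. scale (x l) (h l))
          = (\<Sum>l<dim_col G. \<Sum>k<dim_row H. scale (d k) (scale (H $$ (k, l)) (h l)))"
        by (intro sum.cong) (simp_all add: d scale_sum_left mult.commute)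
      also have "\<dots> = (\<Sum>k<dim_row H. scale (d k) (\<Sum>l<dim_col G. scale (H $$ (k, l)) (h l)))"
        by (subst sum.swap) (simp add: scale_sum_right)
      also have "\<dots> = 0"
        using h dim by (simp add: kernel_flows_def)
      finally show ?thesis
        using scale_x by simp
    qed
    show "h \<in> row_combinations scale G"
      using h dim by (intro row_combinationsI[OF _ hu]) (simp_all add: kernel_flows_def)
  qed
qed (rule row_combinations_subset_kernel_flows[OF dim orth])

end

section \<open>The sum over pairs\<close>

lemma prod_supp:
  fixes f :: "'e \<Rightarrow> 'a::zero" and w :: "'c::comm_monoid_mult"
  assumes "finite E"
  shows "(\<Prod>e\<in>E. if f e = 0 then 1 else w) = w ^ card (supp E f)"
proof -
  have "(\<Prod>e\<in>E. if f e = 0 then 1 else w) = (\<Prod>e\<in>{e \<in> E. f e \<noteq> 0}. w)"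
    using assms by (intro prod.mono_neutral_cong_right) auto
  then show ?thesis
    by (simp add: supp_def)
qed

text \<open>The weight of one column, with \<open>a + y\<close> and \<open>y\<close> for the values
  of \<open>f\<close> and \<open>g\<close>. If \<open>a = 0\<close>, the two factors have product 1.
  Otherwise the summand is 1 except for \<open>w\<close> at \<open>y = 0\<close> and
  \<open>inverse w\<close> at \<open>y = - a\<close>, which are two different elements.\<close>

lemma sum_edge_weight:
  fixes a :: "'a::{ab_group_add, finite}" and w :: "'c::field"
  assumes "w \<noteq> 0"
  shows "(\<Sum>y\<in>UNIV. (if a + y = 0 then 1 else w) * (if y = 0 then 1 else inverse w))
    = (if a = 0 then of_nat CARD('a) else w + inverse w - 2 + of_nat CARD('a))"
proof (cases "a = 0")
  case True
  have "(\<Sum>y\<in>UNIV. (if a + y = 0 then 1 else w) * (if y = 0 then 1 else inverse w))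
      = (\<Sum>y\<in>(UNIV :: 'a set). 1)"
    using True assms by (intro sum.cong) auto
  then show ?thesis
    using True by simp
next
  case False
  have "(\<Sum>y\<in>UNIV. (if a + y = 0 then 1 else w) * (if y = 0 then 1 else inverse w))
      = (\<Sum>y\<in>UNIV. (if y = 0 then w - 1 else 0) + (if y = - a then inverse w - 1 else 0) + 1)"
    using False assms by (intro sum.cong) (auto simp: add_eq_0_iff)
  also have "\<dots> = w + inverse w - 2 + of_nat CARD('a)"
    by (simp add: sum.distrib)
  finally show ?thesis
    using False by simp
qed

lemma power_eq_if_cong:
  fixes w :: "'c::field"
  assumes "w ^ n = 1" "[a = b] (mod n)"
  shows "w ^ a = w ^ b"
proof -
  have "w ^ m = w ^ (m mod n)" for m
  proof -
    have "w ^ m = w ^ (n * (m div n) + m mod n)"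
      by simp
    also have "\<dots> = w ^ (m mod n)"
      unfolding power_add power_mult assms(1) by simp
    finally show ?thesis .
  qed
  then show ?thesis
    using assms(2) unfolding cong_def by metis
qed

text \<open>As \<open>w ^ \<sigma> = 1\<close>, the power of \<open>w\<close> with exponent
  \<open>|supp f| - |supp g|\<close> depends only on the class modulo \<open>\<sigma>\<close> and
  equals \<open>w ^ k\<close> on class \<open>k\<close>. The left side is therefore a sum over all
  pairs, which no longer sees the congruence and splits into columns.\<close>

lemma sum_pairs_M:
  fixes F :: "('e \<Rightarrow> 'a::{ab_group_add, finite}) set" and w :: "'c::field"
  assumes E: "finite E" and F: "F \<subseteq> E \<rightarrow>\<^sub>E UNIV" and \<sigma>: "\<sigma> > 0" and w: "w ^ \<sigma> = 1"
  shows "(\<Sum>k<\<sigma>. w ^ k * of_nat (card (pairs_M E F k \<sigma>)))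
    = (\<Sum>h\<in>F. \<Prod>e\<in>E. if h e = 0 then of_nat CARD('a) else w + inverse w - 2 + of_nat CARD('a))"
proof -
  have w0: "w \<noteq> 0"
    using w \<sigma> by (auto simp: power_0_left)
  define P where "P = {(f, g). f \<in> E \<rightarrow>\<^sub>E UNIV \<and> g \<in> E \<rightarrow>\<^sub>E UNIV \<and> (\<lambda>e\<in>E. f e - g e) \<in> F}"
  define v where "v p = (\<Prod>e\<in>E. (if fst p e = 0 then 1 else w) * (if snd p e = 0 then 1 else inverse w))"
    for p :: "('e \<Rightarrow> 'a) \<times> ('e \<Rightarrow> 'a)"
  have v: "v p = w ^ card (supp E (fst p)) * inverse w ^ card (supp E (snd p))" for p
    unfolding v_def prod.distrib using E by (simp add: prod_supp)
  have finP: "finite P"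
    unfolding P_def using E
    by (intro finite_subset[OF _ finite_cartesian_product[of "E \<rightarrow>\<^sub>E UNIV" "E \<rightarrow>\<^sub>E UNIV"]])
      (auto intro!: finite_PiE)
  have part: "pairs_M E F k \<sigma> = {p \<in> P. (int (card (supp E (fst p))) - int (card (supp E (snd p)))) mod int \<sigma> = int k}"
    if "k < \<sigma>" for k
    using that by (auto simp: pairs_M_def P_def cong_def)
  have vk: "v p = w ^ k" if "p \<in> pairs_M E F k \<sigma>" for p k
  proof -
    let ?a = "card (supp E (fst p))" and ?b = "card (supp E (snd p))"
    have "[int ?a - int ?b = int k] (mod int \<sigma>)"
      using that by (auto simp: pairs_M_def)
    \<comment> \<open>Adding \<open>?b\<close> replaces a difference that may be negative by natural
      exponents.\<close>
    then have "[int ?a - int ?b + int ?b = int k + int ?b] (mod int \<sigma>)"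
      by (rule cong_add) simp
    then have "[?a = k + ?b] (mod \<sigma>)"
      by (simp add: cong_int_iff[symmetric])
    then have "w ^ ?a = w ^ (k + ?b)"
      using w by (intro power_eq_if_cong)
    then show ?thesis
      using w0 by (simp add: v power_add power_inverse)
  qed
  have "(\<Sum>k<\<sigma>. w ^ k * of_nat (card (pairs_M E F k \<sigma>))) = (\<Sum>k<\<sigma>. \<Sum>p\<in>pairs_M E F k \<sigma>. v p)"
    by (intro sum.cong refl) (simp add: vk)
  also have "\<dots> = (\<Sum>k<\<sigma>. \<Sum>p | p \<in> P \<and>
      nat ((int (card (supp E (fst p))) - int (card (supp E (snd p)))) mod int \<sigma>) = k. v p)"
  proof (intro sum.cong refl)
    fix k assume "k \<in> {..<\<sigma>}"
    then show "pairs_M E F k \<sigma> = {p \<in> P.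
        nat ((int (card (supp E (fst p))) - int (card (supp E (snd p)))) mod int \<sigma>) = k}"
      using \<sigma> by (auto simp: part)
  qed
  also have "\<dots> = (\<Sum>p\<in>P. v p)"
    using finP \<sigma> by (intro sum.group) (auto simp: nat_less_iff)
  \<comment> \<open>The shear from \<open>(f, g)\<close> to \<open>(f - g, g)\<close> makes the
    first component range over \<open>F\<close> and leaves \<open>g\<close> unrestricted.\<close>
  also have "\<dots> = (\<Sum>(h, g)\<in>F \<times> (E \<rightarrow>\<^sub>E UNIV).
      \<Prod>e\<in>E. (if h e + g e = 0 then 1 else w) * (if g e = 0 then 1 else inverse w))"
  proof (rule sum.reindex_bij_witness[where i = "\<lambda>(h, g). (\<lambda>e\<in>E. h e + g e, g)"
        and j = "\<lambda>(f, g). (\<lambda>e\<in>E. f e - g e, g)"])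
    fix p assume "p \<in> F \<times> (E \<rightarrow>\<^sub>E (UNIV :: 'a set))"
    then obtain h g where p: "p = (h, g)" "h \<in> F" "h \<in> E \<rightarrow>\<^sub>E UNIV" "g \<in> E \<rightarrow>\<^sub>E UNIV"
      using F by auto
    have "(\<lambda>e\<in>E. (\<lambda>e\<in>E. h e + g e) e - g e) = h"
      using p(3) by (intro extensionalityI[of _ E]) (auto simp: PiE_def)
    with p show "(case case p of (h, g) \<Rightarrow> (\<lambda>e\<in>E. h e + g e, g) of
        (f, g) \<Rightarrow> (\<lambda>e\<in>E. f e - g e, g)) = p"
      and "(case p of (h, g) \<Rightarrow> (\<lambda>e\<in>E. h e + g e, g)) \<in> P"
      by (simp_all add: P_def)
  next
    fix p assume "p \<in> P"
    then obtain f g where p: "p = (f, g)" "f \<in> E \<rightarrow>\<^sub>E UNIV" "g \<in> E \<rightarrow>\<^sub>E UNIV"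
        "(\<lambda>e\<in>E. f e - g e) \<in> F"
      by (auto simp: P_def)
    have "(\<lambda>e\<in>E. (\<lambda>e\<in>E. f e - g e) e + g e) = f"
      using p(2) by (intro extensionalityI[of _ E]) (auto simp: PiE_def)
    with p show "(case case p of (f, g) \<Rightarrow> (\<lambda>e\<in>E. f e - g e, g) of
        (h, g) \<Rightarrow> (\<lambda>e\<in>E. h e + g e, g)) = p"
      and "(case p of (f, g) \<Rightarrow> (\<lambda>e\<in>E. f e - g e, g)) \<in> F \<times> (E \<rightarrow>\<^sub>E UNIV)"
      by simp_all
    show "(case case p of (f, g) \<Rightarrow> (\<lambda>e\<in>E. f e - g e, g) of (h, g) \<Rightarrow>
        \<Prod>e\<in>E. (if h e + g e = 0 then 1 else w) * (if g e = 0 then 1 else inverse w)) = v p"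
      unfolding p(1) v_def by (auto intro!: prod.cong)
  qed
  also have "\<dots> = (\<Sum>h\<in>F. \<Prod>e\<in>E. \<Sum>y\<in>UNIV.
      (if h e + y = 0 then 1 else w) * (if y = 0 then 1 else inverse w))"
    using E by (simp add: prod_sum_PiE sum.cartesian_product)
  finally show ?thesis
    by (simp add: sum_edge_weight w0)
qed

lemma sum_prod_zero_weight:
  fixes F :: "('e \<Rightarrow> 'a::zero) set" and q t :: "'c::comm_ring_1"
  assumes "finite E" "finite F"
  shows "(\<Sum>h\<in>F. \<Prod>e\<in>E. if h e = 0 then q else t)
    = (\<Sum>B\<in>Pow E. (q - t) ^ card B * t ^ card (E - B) * of_nat (card {h \<in> F. \<forall>b\<in>B. h b = 0}))"
proof -
  have "(\<Prod>e\<in>E. if h e = 0 then q else t)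
      = (\<Sum>B\<in>Pow E. (if \<forall>b\<in>B. h b = 0 then (q - t) ^ card B * t ^ card (E - B) else 0))" for h :: "'e \<Rightarrow> 'a"
  proof -
    \<comment> \<open>The summand \<open>q - t\<close> is present only where \<open>h\<close>
      vanishes, so a set \<open>B\<close> of columns at which it is chosen contributes only if
      \<open>h\<close> is zero on all of \<open>B\<close>.\<close>
    have "(\<Prod>e\<in>E. if h e = 0 then q else t) = (\<Prod>e\<in>E. (if h e = 0 then q - t else 0) + t)"
      by (intro prod.cong) auto
    also have "\<dots> = (\<Sum>B\<in>Pow E. (\<Prod>b\<in>B. if h b = 0 then q - t else 0) * t ^ card (E - B))"
      using assms(1) by (simp add: prod_add)
    also have "\<dots> = (\<Sum>B\<in>Pow E. (if \<forall>b\<in>B. h b = 0 then (q - t) ^ card B * t ^ card (E - B) else 0))"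
    proof (intro sum.cong refl)
      fix B assume "B \<in> Pow E"
      then have "finite B"
        using assms(1) finite_subset by blast
      then show "(\<Prod>b\<in>B. if h b = 0 then q - t else 0) * t ^ card (E - B)
          = (if \<forall>b\<in>B. h b = 0 then (q - t) ^ card B * t ^ card (E - B) else 0)"
        by (cases "\<forall>b\<in>B. h b = 0") (simp, subst prod_zero, auto)
    qed
    finally show ?thesis .
  qed
  then have "(\<Sum>h\<in>F. \<Prod>e\<in>E. if h e = 0 then q else t)
      = (\<Sum>B\<in>Pow E. \<Sum>h\<in>F. if \<forall>b\<in>B. h b = 0 then (q - t) ^ card B * t ^ card (E - B) else 0)"
    by (simp add: sum.swap[of _ F])
  also have "\<dots> = (\<Sum>B\<in>Pow E. (q - t) ^ card B * t ^ card (E - B) * of_nat (card {h \<in> F. \<forall>b\<in>B. h b = 0}))"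
    using assms(2) by (intro sum.cong refl) (simp add: sum.inter_filter[symmetric])
  finally show ?thesis .
qed

section \<open>The rank generating polynomial\<close>

lemma finite_row_combinations:
  "finite (row_combinations sm G :: (nat \<Rightarrow> 'a::{comm_monoid_add, finite}) set)"
  unfolding row_combinations_def
  by (rule finite_subset[of _ "col_set G \<rightarrow>\<^sub>E UNIV"]) (auto intro!: finite_PiE)

lemma weighted_rank_sum:
  fixes s t :: real
  assumes E: "finite E" and s: "s \<noteq> 0" and t: "t \<noteq> 0"
    and rk: "\<And>B. B \<subseteq> E \<Longrightarrow> rk B \<le> rk E" "\<And>B. B \<subseteq> E \<Longrightarrow> rk B \<le> card B"
  shows "(\<Sum>B\<in>Pow E. s ^ card B * t ^ card (E - B) * q ^ (rk E - rk B))
    = s ^ rk E * t ^ (card E - rk E) * rank_gen_poly E rk (q * t / s) (s / t)"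
  unfolding rank_gen_poly_def sum_distrib_left
proof (intro sum.cong refl)
  fix B assume "B \<in> Pow E"
  then have B: "B \<subseteq> E"
    by simp
  have "finite B" "card B \<le> card E"
    using B E by (auto intro: finite_subset card_mono)
  \<comment> \<open>With \<open>a\<close> the corank and \<open>b\<close> the nullity of
    \<open>B\<close>, and \<open>d\<close> the nullity of \<open>E\<close>, the complement of
    \<open>B\<close> has \<open>a + d - b\<close> elements. The subtracted \<open>b\<close> is what
    puts \<open>t\<close> into a denominator.\<close>
  obtain a where a: "rk E = rk B + a"
    using rk(1)[OF B] le_Suc_ex by blast
  obtain b where b: "card B = rk B + b"
    using rk(2)[OF B] le_Suc_ex by blast
  obtain d where d: "card E = rk E + d"
    using rk(2)[of E] le_Suc_ex by blast
  have cEB: "card (E - B) = rk B + a + d - (rk B + b)"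
    using B \<open>finite B\<close> by (simp add: card_Diff_subset a b d)
  have "t ^ card (E - B) * t ^ b = t ^ (a + d)"
    using \<open>card B \<le> card E\<close> by (simp add: cEB a b d flip: power_add)
  then have "t ^ card (E - B) = t ^ (a + d) / t ^ b"
    using t by (simp add: field_simps)
  then show "s ^ card B * t ^ card (E - B) * q ^ (rk E - rk B)
      = s ^ rk E * t ^ (card E - rk E) * ((q * t / s) ^ (rk E - rk B) * (s / t) ^ (card B - rk B))"
    using s t by (simp add: a b d power_add power_mult_distrib power_divide field_simps)
qed

context finite_module
begin

lemma col_rk_le_card:
  assumes "finite B"
  shows "col_rk G B \<le> card B"
proof -
  obtain I where "basis_of_cols G B I" "card I = col_rk G B"
    using col_rk_attained[OF assms] .
  then show ?thesis
    using assms by (metis basis_of_cols_def card_mono)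
qed

lemma sum_pairs_M_row_combinations:
  fixes \<theta> :: real
  defines "\<omega> \<equiv> exp (\<i> * complex_of_real \<theta>)" and "q \<equiv> CARD('a)"
  assumes uni: "unimodular_mat G" and q: "q \<ge> 2"
    and \<sigma>: "\<sigma> > 0" "\<omega> ^ \<sigma> = 1" and s: "2 - 2 * cos \<theta> \<noteq> 0" and t: "2 * cos \<theta> - 2 + real q \<noteq> 0"
  shows "(\<Sum>k<\<sigma>. \<omega> ^ k * of_nat (card (pairs_M (col_set G) (row_combinations scale G) k \<sigma>)))
    = complex_of_real ((2 - 2 * cos \<theta>) ^ col_rk G (col_set G) *
        (2 * cos \<theta> - 2 + real q) ^ (card (col_set G) - col_rk G (col_set G)) *
        rank_gen_poly (col_set G) (col_rk G)
          (real q * (2 * cos \<theta> - 2 + real q) / (2 - 2 * cos \<theta>))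
          ((2 - 2 * cos \<theta>) / (2 * cos \<theta> - 2 + real q)))"
proof -
  let ?E = "col_set G" and ?F = "row_combinations scale G"
  define t where "t = 2 * cos \<theta> - 2 + real q"
  have \<omega>: "\<omega> = cis \<theta>"
    by (simp add: \<omega>_def cis_conv_exp)
  \<comment> \<open>On the unit circle \<open>inverse \<omega>\<close> is the conjugate of
    \<open>\<omega>\<close>, so their sum is \<open>2 * cos \<theta>\<close>.\<close>
  have weight: "\<omega> + inverse \<omega> - 2 + of_nat CARD('a) = complex_of_real t"
    by (simp add: \<omega> t_def q_def complex_eq_iff)
  have "?F \<subseteq> ?E \<rightarrow>\<^sub>E UNIV"
    by (auto simp: row_combinations_def)
  then have "(\<Sum>k<\<sigma>. \<omega> ^ k * of_nat (card (pairs_M ?E ?F k \<sigma>)))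
      = (\<Sum>h\<in>?F. \<Prod>e\<in>?E. if h e = 0 then of_nat q else complex_of_real t)"
    unfolding q_def weight[symmetric] using \<sigma> by (intro sum_pairs_M) simp_all
  also have "\<dots> = (\<Sum>B\<in>Pow ?E. (of_nat q - complex_of_real t) ^ card B * complex_of_real t ^ card (?E - B) *
      of_nat (card {h \<in> ?F. \<forall>b\<in>B. h b = 0}))"
    by (intro sum_prod_zero_weight) (simp_all add: finite_row_combinations)
  also have "\<dots> = (\<Sum>B\<in>Pow ?E. complex_of_real ((2 - 2 * cos \<theta>) ^ card B * t ^ card (?E - B) *
      real q ^ (col_rk G ?E - col_rk G B)))"
  proof (intro sum.cong refl)
    fix B assume B: "B \<in> Pow ?E"
    have "of_nat q - complex_of_real t = complex_of_real (2 - 2 * cos \<theta>)"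
      by (simp add: t_def)
    with B show "(of_nat q - complex_of_real t) ^ card B * complex_of_real t ^ card (?E - B) *
        of_nat (card {h \<in> ?F. \<forall>b\<in>B. h b = 0}) =
        complex_of_real ((2 - 2 * cos \<theta>) ^ card B * t ^ card (?E - B) * real q ^ (col_rk G ?E - col_rk G B))"
      using card_row_combinations_vanishing[OF uni, of B] q by (simp add: q_def)
  qed
  also have "\<dots> = complex_of_real (\<Sum>B\<in>Pow ?E. (2 - 2 * cos \<theta>) ^ card B * t ^ card (?E - B) *
      real q ^ (col_rk G ?E - col_rk G B))"
    by simp
  also have "(\<Sum>B\<in>Pow ?E. (2 - 2 * cos \<theta>) ^ card B * t ^ card (?E - B) * real q ^ (col_rk G ?E - col_rk G B))
      = (2 - 2 * cos \<theta>) ^ col_rk G ?E * t ^ (card ?E - col_rk G ?E) *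
        rank_gen_poly ?E (col_rk G) (real q * t / (2 - 2 * cos \<theta>)) ((2 - 2 * cos \<theta>) / t)"
    using s t by (intro weighted_rank_sum) (auto simp: t_def intro: col_rk_mono col_rk_le_card finite_subset)
  finally show ?thesis
    by (simp only: t_def)
qed

end

text \<open>\<open>m * \<theta>\<close> is a multiple of \<open>2 * pi\<close> only if
  \<open>\<sigma>\<close> divides \<open>m * \<rho>\<close>, and \<open>\<rho>\<close> is prime to
  \<open>\<sigma>\<close>. In this way a particular value of \<open>cos \<theta>\<close> restricts
  \<open>\<sigma>\<close>.\<close>

lemma dvd_if_cos_multiple_eq_1:
  assumes "\<sigma> > 0" "coprime \<rho> (int \<sigma>)" "\<theta> = 2 * real_of_int \<rho> * pi / real \<sigma>"
    and "cos (real m * \<theta>) = 1"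
  shows "\<sigma> dvd m"
proof -
  obtain n :: int where n: "real m * \<theta> = real_of_int n * 2 * pi"
    using assms(4) cos_one_2pi_int by blast
  then have "real m * (2 * real_of_int \<rho>) * pi = real_of_int n * 2 * real \<sigma> * pi"
    using assms(1,3) by (simp add: field_simps)
  then have "real_of_int (int m * \<rho>) = real_of_int (n * int \<sigma>)"
    by simp
  then have "int m * \<rho> = n * int \<sigma>"
    by (simp only: of_int_eq_iff)
  then have "int \<sigma> dvd int m"
    using assms(2) by (metis coprime_commute coprime_dvd_mult_left_iff dvd_triv_right)
  then show ?thesis
    by simp
qed

text \<open>A zero of the second weight has \<open>q \<le> 4\<close>, as the cosine is at least -1.
  For \<open>q = 2, 3, 4\<close> it requires \<open>cos \<theta> = 0, -1/2, -1\<close>, hence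
  \<open>\<omega>\<close> is a root of unity of order dividing 4, 3, 2 respectively; the excluded
  pairs are those of exact order.\<close>

lemma weights_nonzero:
  assumes \<sigma>: "\<sigma> > 1" and cop: "coprime \<rho> (int \<sigma>)" and \<theta>: "\<theta> = 2 * real_of_int \<rho> * pi / real \<sigma>"
  shows "2 - 2 * cos \<theta> \<noteq> 0"
    and "q \<ge> 2 \<Longrightarrow> \<not> (\<sigma> = 2 \<and> q = 4) \<Longrightarrow> \<not> (\<sigma> = 3 \<and> q = 3) \<Longrightarrow> \<not> (\<sigma> = 4 \<and> q = 2) \<Longrightarrow>
      2 * cos \<theta> - 2 + real q \<noteq> 0"
proof -
  have dvd: "\<sigma> dvd m" if "cos (real m * \<theta>) = 1" for m
    using dvd_if_cos_multiple_eq_1[OF _ cop \<theta> that] \<sigma> by simp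
  show "2 - 2 * cos \<theta> \<noteq> 0"
    using dvd[of 1] \<sigma> by auto
  assume q: "q \<ge> 2" "\<not> (\<sigma> = 2 \<and> q = 4)" "\<not> (\<sigma> = 3 \<and> q = 3)" "\<not> (\<sigma> = 4 \<and> q = 2)"
  show "2 * cos \<theta> - 2 + real q \<noteq> 0"
  proof
    assume eq: "2 * cos \<theta> - 2 + real q = 0"
    then have "real q \<le> 4"
      using cos_ge_minus_one[of \<theta>] by linarith
    with q(1) consider "q = 2" | "q = 3" | "q = 4"
      by linarith
    then show False
    proof cases
      case 1
      then have c2: "cos (2 * \<theta>) = -1"
        using eq by (simp add: cos_double_cos)
      have "cos (2 * (2 * \<theta>)) = 1"
        unfolding cos_double_cos[of "2 * \<theta>"] c2 by simp
      then have "\<sigma> dvd 4"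
        by (intro dvd) simp
      then have "\<sigma> \<le> 4"
        by (rule dvd_imp_le) simp
      moreover have "\<sigma> \<noteq> 3"
        using \<open>\<sigma> dvd 4\<close> by auto
      \<comment> \<open>Besides the excluded order 4, its divisor 2 remains; there
        \<open>\<theta>\<close> is a multiple of \<open>pi\<close> and its cosine is not
        zero.\<close>
      ultimately have "\<sigma> = 2"
        using \<sigma> q(4) 1 by linarith
      then have "2 * \<theta> = 2 * pi * real_of_int \<rho>"
        using \<theta> by simp
      then have "cos (2 * \<theta>) = 1"
        by (simp only: cos_int_2pin)
      with c2 show False
        by simp
    next
      case 2
      then have "cos \<theta> = -1 / 2"
        using eq by simp
      then have "cos (3 * \<theta>) = 1"
        by (simp add: cos_treble_cos power3_eq_cube)
      then have "\<sigma> dvd 3"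
        by (intro dvd) simp
      then have "\<sigma> \<le> 3"
        by (rule dvd_imp_le) simp
      moreover have "\<sigma> \<noteq> 2"
        using \<open>\<sigma> dvd 3\<close> by auto
      ultimately show False
        using \<sigma> q(3) 2 by linarith
    next
      case 3
      then have "cos \<theta> = -1"
        using eq by simp
      then have "cos (2 * \<theta>) = 1"
        by (simp add: cos_double_cos)
      then have "\<sigma> dvd 2"
        by (intro dvd) simp
      then have "\<sigma> \<le> 2"
        by (rule dvd_imp_le) simp
      then show False
        using \<sigma> q(2) 3 by linarith
    qed
  qed
qed

section \<open>Rank, minors and duality\<close>

text \<open>\<open>mat_rank\<close> concerns the set of column vectors, \<open>col_rk\<close> the
  set of column indices. Equal columns at different indices are dependent, so \<open>col A\<close>
  is injective on independent index sets, and a basis of indices maps to a maximal independent set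
  of vectors.\<close>

lemma mat_rank_eq_col_rk:
  fixes A :: "'k::field mat"
  shows "mat_rank A = col_rk A (col_set A)"
proof -
  interpret vec_space "TYPE('k)" "dim_row A" .
  have carr: "col A ` I \<subseteq> carrier_vec (dim_row A)" for I
    by auto
  have lc: "lincomb a (col A ` I) = 0\<^sub>v (dim_row A) \<longleftrightarrow>
      (\<forall>i<dim_row A. (\<Sum>j\<in>I. a (col A j) * A $$ (i, j)) = 0)"
    if "inj_on (col A) I" "I \<subseteq> col_set A" for a I
  proof -
    have "lincomb a (col A ` I) $ i = (\<Sum>j\<in>I. a (col A j) * A $$ (i, j))" if "i < dim_row A" for i
      using that \<open>I \<subseteq> col_set A\<close>
      by (auto simp: lincomb_index[OF that carr] sum.reindex[OF \<open>inj_on (col A) I\<close>] intro!: sum.cong)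
    moreover have "dim_vec (lincomb a (col A ` I)) = dim_row A"
      using lincomb_dim[of "col A ` I" a] that(2) finite_subset carr by auto
    ultimately show ?thesis
      by (auto simp: vec_eq_iff)
  qed
  have inj: "inj_on (col A) I" if "independent_cols A I" "I \<subseteq> col_set A" for I
  proof (rule inj_onI, rule ccontr)
    fix i j assume ij: "i \<in> I" "j \<in> I" "col A i = col A j" "i \<noteq> j"
    have finI: "finite I"
      using that(2) finite_subset by blast
    define c :: "nat \<Rightarrow> 'k" where "c l = (if l = i then 1 else 0) - (if l = j then 1 else 0)" for l
    have "(\<Sum>l\<in>I. c l * A $$ (k, l)) = 0" if "k < dim_row A" for k
    proof -
      have "(\<Sum>l\<in>I. c l * A $$ (k, l))
          = (\<Sum>l\<in>I. (if l = i then A $$ (k, l) else 0) - (if l = j then A $$ (k, l) else 0))"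
        by (intro sum.cong) (auto simp: c_def)
      also have "\<dots> = A $$ (k, i) - A $$ (k, j)"
        using ij finI by (simp add: sum_subtractf)
      also have "A $$ (k, i) = A $$ (k, j)"
        using arg_cong[OF ij(3), of "\<lambda>v. v $ k"] ij(1,2) \<open>I \<subseteq> col_set A\<close> that by (simp add: subset_iff)
      finally show ?thesis
        by simp
    qed
    then have "c i = 0"
      using that(1) ij(1) by (simp add: independent_cols_def)
    then show False
      using ij(4) by (simp add: c_def)
  qed
  obtain I where I: "basis_of_cols A (col_set A) I" "card I = col_rk A (col_set A)"
    using col_rk_attained by blast
  then have IE: "I \<subseteq> col_set A" and indI: "independent_cols A I"
    and maxI: "\<And>b. b \<in> col_set A - I \<Longrightarrow> \<not> independent_cols A (insert b I)"
    by (auto simp: basis_of_cols_def)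
  have injI: "inj_on (col A) I"
    using inj indI IE .
  have finI: "finite I"
    using IE finite_subset by blast
  have cols: "set (cols A) = col A ` col_set A"
    by (auto simp: cols_def)
  have "maximal (col A ` I) (\<lambda>T. T \<subseteq> set (cols A) \<and> lin_indpt T)"
    unfolding maximal_def
  proof (intro conjI allI impI)
    show "col A ` I \<subseteq> set (cols A)"
      using IE cols by auto
    show "lin_indpt (col A ` I)"
    proof (rule finite_lin_indpt2[OF _ carr])
      fix a assume "lincomb a (col A ` I) = 0\<^sub>v (dim_row A)"
      then have "\<forall>i<dim_row A. (\<Sum>j\<in>I. a (col A j) * A $$ (i, j)) = 0"
        using lc[OF injI IE, of a] by (rule iffD1[rotated])
      then have "\<forall>j\<in>I. a (col A j) = 0"
        using spec[OF indI[unfolded independent_cols_def], of "\<lambda>j. a (col A j)"] by (rule rev_mp)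
      then show "\<forall>v\<in>col A ` I. a v = 0"
        by blast
    qed (use finI in simp)
    fix T assume T: "col A ` I \<subseteq> T \<and> T \<subseteq> set (cols A) \<and> lin_indpt T"
    have "x \<in> col A ` I" if x: "x \<in> T" for x
    proof (rule ccontr)
      assume notin: "x \<notin> col A ` I"
      obtain b where b: "b < dim_col A" "x = col A b"
        using x T cols by auto
      let ?J = "insert b I"
      have injJ: "inj_on (col A) ?J"
        using injI notin b by auto
      have JE: "?J \<subseteq> col_set A"
        using b IE by auto
      have "independent_cols A ?J"
        unfolding independent_cols_def
      proof (intro allI impI)
        fix c assume c: "\<forall>i<dim_row A. (\<Sum>j\<in>?J. c j * A $$ (i, j)) = 0"
        \<comment> \<open>Coefficients are carried from indices to vectors along the inverse of
          \<open>col A\<close> on \<open>?J\<close>.\<close>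
        define a where "a v = c (the_inv_into ?J (col A) v)" for v
        have a: "a (col A j) = c j" if "j \<in> ?J" for j
          unfolding a_def using that by (simp only: the_inv_into_f_f[OF injJ])
        then have "(\<Sum>j\<in>?J. a (col A j) * A $$ (i, j)) = (\<Sum>j\<in>?J. c j * A $$ (i, j))" for i
          by (intro sum.cong) auto
        then have "lincomb a (col A ` ?J) = 0\<^sub>v (dim_row A)"
          using lc[OF injJ JE, of a] c by simp
        then have zero: "a \<in> col A ` ?J \<rightarrow> {0}"
          using T x b(2) finI by (intro not_lindepD[of T]) auto
        have "c j = 0" if "j \<in> ?J" for j
          using Pi_mem[OF zero imageI[OF that]] a[OF that] by simp
        then show "\<forall>j\<in>?J. c j = 0"
          by blast
      qed
      moreover have "b \<in> col_set A - I"
        using b notin by auto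
      ultimately show False
        using maxI by blast
    qed
    with T show "T = col A ` I"
      by blast
  qed
  then have "mat_rank A = card (col A ` I)"
    by (intro rank_card_indpt[of A "dim_col A"]) auto
  then show ?thesis
    using I(2) card_image[OF injI] by simp
qed

lemma matroid_rk_eq_col_rk: "matroid_rk A = col_rk A"
  by (simp add: fun_eq_iff matroid_rk_def col_rk_def indep_cols_def independent_cols_def)

section \<open>Integral and rational independence\<close>

lemma ex_int_common_denominator:
  fixes c :: "'b \<Rightarrow> rat"
  assumes "finite I"
  shows "\<exists>N d. N \<noteq> 0 \<and> (\<forall>j\<in>I. rat_of_int N * c j = rat_of_int (d j))"
  using assms
proof induction
  case empty
  then show ?case
    by (intro exI[of _ 1]) auto
next
  case (insert i I)
  then obtain N d where N: "N \<noteq> 0" "\<And>j. j \<in> I \<Longrightarrow> rat_of_int N * c j = rat_of_int (d j)"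
    by blast
  obtain a b where ab: "c i = of_int a / of_int b" "b > 0"
    using quotient_of_div[of "c i"] quotient_of_denom_pos[of "c i"] by (metis prod.exhaust)
  have "rat_of_int (N * b) * c j = rat_of_int (if j = i then N * a else b * d j)" if "j \<in> insert i I" for j
  proof (cases "j = i")
    case True
    then show ?thesis
      using ab by simp
  next
    case False
    then show ?thesis
      using N(2)[of j] that by (simp add: mult_ac)
  qed
  moreover have "N * b \<noteq> 0"
    using N(1) ab(2) by simp
  ultimately show ?case
    by (intro exI[of _ "N * b"] exI[of _ "\<lambda>j. if j = i then N * a else b * d j"]) simp
qed

text \<open>A rational relation becomes an integral one after multiplication by a common
  denominator, so integral independence describes the matroid over the rationals.\<close>

lemma independent_cols_of_int_iff:
  assumes "I \<subseteq> col_set G"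
  shows "independent_cols (map_mat rat_of_int G) I \<longleftrightarrow> independent_cols G I"
proof
  have entry: "map_mat rat_of_int G $$ (i, j) = rat_of_int (G $$ (i, j))" if "i < dim_row G" "j \<in> I" for i j
    using that assms by auto
  show "independent_cols G I" if indep: "independent_cols (map_mat rat_of_int G) I"
    unfolding independent_cols_def
  proof (intro allI impI)
    fix c assume c: "\<forall>i<dim_row G. (\<Sum>j\<in>I. c j * G $$ (i, j)) = 0"
    have "(\<Sum>j\<in>I. rat_of_int (c j) * map_mat rat_of_int G $$ (i, j)) = 0"
      if "i < dim_row (map_mat rat_of_int G)" for i
    proof -
      from that have "i < dim_row G"
        by simp
      have "(\<Sum>j\<in>I. rat_of_int (c j) * map_mat rat_of_int G $$ (i, j)) = rat_of_int (\<Sum>j\<in>I. c j * G $$ (i, j))"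
        using entry[OF \<open>i < dim_row G\<close>] by simp
      then show ?thesis
        using c \<open>i < dim_row G\<close> by simp
    qed
    then have "rat_of_int (c j) = 0" if "j \<in> I" for j
      using independent_colsD[OF indep _ that, of "\<lambda>j. rat_of_int (c j)"] by blast
    then show "\<forall>j\<in>I. c j = 0"
      by simp
  qed
  show "independent_cols (map_mat rat_of_int G) I" if indep: "independent_cols G I"
    unfolding independent_cols_def
  proof (intro allI impI)
    fix c assume c: "\<forall>i<dim_row (map_mat rat_of_int G). (\<Sum>j\<in>I. c j * map_mat rat_of_int G $$ (i, j)) = 0"
    obtain N d where N: "N \<noteq> 0" "\<And>j. j \<in> I \<Longrightarrow> rat_of_int N * c j = rat_of_int (d j)"
      using ex_int_common_denominator[OF finite_subset[OF assms], of c] by auto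
    have "(\<Sum>j\<in>I. d j * G $$ (i, j)) = 0" if "i < dim_row G" for i
    proof -
      have "rat_of_int (\<Sum>j\<in>I. d j * G $$ (i, j)) = (\<Sum>j\<in>I. rat_of_int N * c j * map_mat rat_of_int G $$ (i, j))"
        using entry[OF that] N(2) by simp
      also have "\<dots> = rat_of_int N * (\<Sum>j\<in>I. c j * map_mat rat_of_int G $$ (i, j))"
        by (simp add: sum_distrib_left mult.assoc)
      also have "\<dots> = 0"
        using c that by simp
      finally show ?thesis
        by (simp only: of_int_eq_0_iff)
    qed
    then have "d j = 0" if "j \<in> I" for j
      using independent_colsD[OF indep _ that] by blast
    then show "\<forall>j\<in>I. c j = 0"
      using N by fastforce
  qed
qed

lemma col_rk_of_int:
  assumes "B \<subseteq> col_set G"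
  shows "col_rk (map_mat rat_of_int G) B = col_rk G B"
proof -
  have "{I. I \<subseteq> B \<and> independent_cols (map_mat rat_of_int G) I} = {I. I \<subseteq> B \<and> independent_cols G I}"
    using assms by (auto simp: independent_cols_of_int_iff)
  then show ?thesis
    by (simp add: col_rk_def)
qed

text \<open>Elimination column by column. The rows in \<open>K\<close> form a regular square system
  for \<open>I\<close>; subtracting from column \<open>i\<close> the combination that agrees with it
  on \<open>K\<close> leaves a vector \<open>v\<close> that is zero on \<open>K\<close>, and any row
  where \<open>v\<close> is nonzero enlarges the system. Surjectivity is carried along because it
  supplies that combination; injectivity is what the minors need.\<close>

lemma ex_rows_regular:
  fixes A :: "'k::field mat"
  assumes "finite I" "independent_cols A I"
  shows "\<exists>K \<subseteq> {..<dim_row A}. card K = card I \<and>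
    (\<forall>c. (\<forall>k\<in>K. (\<Sum>j\<in>I. c j * A $$ (k, j)) = 0) \<longrightarrow> (\<forall>j\<in>I. c j = 0)) \<and>
    (\<forall>w. \<exists>c. \<forall>k\<in>K. (\<Sum>j\<in>I. c j * A $$ (k, j)) = w k)"
  using assms
proof (induction I)
  case empty
  then show ?case
    by (intro exI[of _ "{}"]) auto
next
  case (insert i I)
  have indep: "independent_cols A I"
    using insert.hyps(1) by (intro independent_cols_subset[OF insert.prems]) auto
  then obtain K where K: "K \<subseteq> {..<dim_row A}" "card K = card I"
    and inj: "\<forall>c. (\<forall>k\<in>K. (\<Sum>j\<in>I. c j * A $$ (k, j)) = 0) \<longrightarrow> (\<forall>j\<in>I. c j = 0)"
    and surj: "\<forall>w. \<exists>c. \<forall>k\<in>K. (\<Sum>j\<in>I. c j * A $$ (k, j)) = w k"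
    using insert.IH[OF indep] by (elim exE conjE) (rule that)
  have finK: "finite K"
    using K(1) finite_subset by blast
  obtain b where b: "\<forall>k\<in>K. (\<Sum>j\<in>I. b j * A $$ (k, j)) = A $$ (k, i)"
    using spec[OF surj, of "\<lambda>k. A $$ (k, i)"] by (rule exE)
  define v where "v k = A $$ (k, i) - (\<Sum>j\<in>I. b j * A $$ (k, j))" for k
  have vK: "v k = 0" if "k \<in> K" for k
    using b that by (simp add: v_def)
  have "\<exists>l<dim_row A. v l \<noteq> 0"
  proof (rule ccontr)
    assume none: "\<not> (\<exists>l<dim_row A. v l \<noteq> 0)"
    define c where "c j = (if j = i then 1 else - b j)" for j
    have "(\<Sum>j\<in>insert i I. c j * A $$ (k, j)) = v k" for k
    proof -
      have "(\<Sum>j\<in>I. c j * A $$ (k, j)) = (\<Sum>j\<in>I. - (b j * A $$ (k, j)))"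
        using insert.hyps(2) by (intro sum.cong) (auto simp: c_def)
      then show ?thesis
        using insert.hyps by (simp add: c_def v_def sum_negf)
    qed
    then have "c i = 0"
      using none insert.prems unfolding independent_cols_def by auto
    then show False
      by (simp add: c_def)
  qed
  then obtain l where l: "l < dim_row A" "v l \<noteq> 0"
    by blast
  then have lK: "l \<notin> K"
    using vK by blast
  have expand: "(\<Sum>j\<in>insert i I. c j * A $$ (k, j)) = c i * v k + (\<Sum>j\<in>I. (c j + c i * b j) * A $$ (k, j))" for c k
    using insert.hyps by (simp add: v_def algebra_simps sum.distrib sum_distrib_left)
  show ?case
  proof (intro exI[of _ "insert l K"] conjI allI impI)
    show "insert l K \<subseteq> {..<dim_row A}"
      using K(1) l(1) by simp
    show "card (insert l K) = card (insert i I)"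
      using K(2) lK finK insert.hyps by simp
    show "\<forall>j\<in>insert i I. c j = 0"
      if c: "\<forall>k\<in>insert l K. (\<Sum>j\<in>insert i I. c j * A $$ (k, j)) = 0" for c
    proof -
      have z: "\<forall>j\<in>I. c j + c i * b j = 0"
      proof (rule mp[OF spec[OF inj]], rule ballI)
        fix k assume "k \<in> K"
        then show "(\<Sum>j\<in>I. (c j + c i * b j) * A $$ (k, j)) = 0"
          using c expand[of c k] vK by simp
      qed
      have "c i * v l + (\<Sum>j\<in>I. (c j + c i * b j) * A $$ (l, j)) = 0"
        using c expand[of c l] by simp
      then have "c i = 0"
        using z l(2) by simp
      with z show ?thesis
        by auto
    qed
    show "\<exists>c. \<forall>k\<in>insert l K. (\<Sum>j\<in>insert i I. c j * A $$ (k, j)) = w k" for w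
    proof -
      obtain a where a: "\<forall>k\<in>K. (\<Sum>j\<in>I. a j * A $$ (k, j)) = w k"
        using spec[OF surj] by (rule exE)
      \<comment> \<open>\<open>x\<close> corrects the value at row \<open>l\<close>; replacing
        \<open>a j\<close> by \<open>a j - x * b j\<close> compensates for the new column on the
        rows in \<open>K\<close>.\<close>
      define x where "x = (w l - (\<Sum>j\<in>I. a j * A $$ (l, j))) / v l"
      define c where "c j = (if j = i then x else a j - x * b j)" for j
      have "(\<Sum>j\<in>insert i I. c j * A $$ (k, j)) = x * v k + (\<Sum>j\<in>I. a j * A $$ (k, j))" for k
      proof -
        have "(\<Sum>j\<in>I. (c j + c i * b j) * A $$ (k, j)) = (\<Sum>j\<in>I. a j * A $$ (k, j))"
          using insert.hyps(2) by (intro sum.cong) (auto simp: c_def)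
        then show ?thesis
          unfolding expand by (simp add: c_def)
      qed
      then have "\<forall>k\<in>insert l K. (\<Sum>j\<in>insert i I. c j * A $$ (k, j)) = w k"
        using a vK l(2) by (auto simp: x_def)
      then show ?thesis
        by (intro exI[of _ c])
    qed
  qed
qed

text \<open>The function is the position of \<open>i\<close> in \<open>I\<close> listed
  increasingly, which is the index that \<open>i\<close> receives in a submatrix.\<close>

lemma bij_betw_card_less:
  fixes I :: "'b::linorder set"
  assumes "finite I"
  shows "bij_betw (\<lambda>i. card {a \<in> I. a < i}) I {..<card I}"
proof (rule bij_betw_imageI)
  have less: "card {a \<in> I. a < i} < card {a \<in> I. a < j}" if "i \<in> I" "i < j" for i j
    using assms that by (intro psubset_card_mono) auto
  show inj: "inj_on (\<lambda>i. card {a \<in> I. a < i}) I"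
  proof (rule inj_onI)
    fix i j assume "i \<in> I" "j \<in> I" "card {a \<in> I. a < i} = card {a \<in> I. a < j}"
    then show "i = j"
      using less[of i j] less[of j i] by (cases i j rule: linorder_cases) simp_all
  qed
  have "card {a \<in> I. a < i} < card I" if "i \<in> I" for i
    using assms that by (intro psubset_card_mono) auto
  then have "(\<lambda>i. card {a \<in> I. a < i}) ` I \<subseteq> {..<card I}"
    by auto
  then show "(\<lambda>i. card {a \<in> I. a < i}) ` I = {..<card I}"
    by (intro card_subset_eq) (simp_all add: card_image[OF inj])
qed

lemma submatrix_carrier:
  assumes "K \<subseteq> {..<dim_row A}" "I \<subseteq> col_set A"
  shows "submatrix A K I \<in> carrier_mat (card K) (card I)"
proof -
  have "{k. k < dim_row A \<and> k \<in> K} = K" "{j. j < dim_col A \<and> j \<in> I} = I"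
    using assms by auto
  then show ?thesis
    by (intro carrier_matI) (simp_all add: dim_submatrix)
qed

text \<open>A kernel vector of a singular minor on the regular rows \<open>K\<close>, read back
  along the positions of \<open>I\<close>, would be a nontrivial relation of the columns in
  \<open>I\<close> on the rows in \<open>K\<close>.\<close>

lemma ex_nonzero_minor:
  fixes A :: "'k::field mat"
  assumes I: "I \<subseteq> col_set A" and indep: "independent_cols A I"
  obtains K where "K \<subseteq> {..<dim_row A}" "card K = card I" "det (submatrix A K I) \<noteq> 0"
proof -
  have finI: "finite I"
    using I finite_subset by blast
  obtain K where K: "K \<subseteq> {..<dim_row A}" "card K = card I"
    and inj: "\<forall>c. (\<forall>k\<in>K. (\<Sum>j\<in>I. c j * A $$ (k, j)) = 0) \<longrightarrow> (\<forall>j\<in>I. c j = 0)"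
    using ex_rows_regular[OF finI indep] by (elim exE conjE) (rule that)
  let ?p = "\<lambda>i. card {a \<in> I. a < i}"
  let ?M = "submatrix A K I"
  have M: "?M \<in> carrier_mat (card I) (card I)"
    using submatrix_carrier[OF K(1) I] K(2) by simp
  have p: "bij_betw ?p I {..<card I}"
    using finI by (rule bij_betw_card_less)
  have "det ?M \<noteq> 0"
  proof
    assume "det ?M = 0"
    then obtain x where x: "x \<in> carrier_vec (card I)" "x \<noteq> 0\<^sub>v (card I)" "?M *\<^sub>v x = 0\<^sub>v (card I)"
      using det_0_iff_vec_prod_zero_field[OF M] by blast
    have "(\<Sum>j\<in>I. x $ ?p j * A $$ (k, j)) = 0" if k: "k \<in> K" for k
    proof -
      let ?r = "card {a \<in> K. a < k}"
      have r: "?r < card I"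
        using bij_betw_apply[OF bij_betw_card_less k] K finite_subset by fastforce
      have "(\<Sum>j\<in>I. x $ ?p j * A $$ (k, j)) = (\<Sum>j\<in>I. x $ ?p j * ?M $$ (?r, ?p j))"
      proof (intro sum.cong refl)
        fix j assume "j \<in> I"
        then show "x $ ?p j * A $$ (k, j) = x $ ?p j * ?M $$ (?r, ?p j)"
          using submatrix_index_card[of k A j K I] k K(1) I by (simp add: subset_iff)
      qed
      also have "\<dots> = (\<Sum>b<card I. x $ b * ?M $$ (?r, b))"
        using sum.reindex_bij_betw[OF p] .
      also have "\<dots> = (?M *\<^sub>v x) $ ?r"
        using r M x(1) by (auto simp: scalar_prod_def lessThan_atLeast0 mult.commute intro!: sum.cong)
      finally show ?thesis
        using x(3) r by simp
    qed
    then have "\<forall>k\<in>K. (\<Sum>j\<in>I. x $ ?p j * A $$ (k, j)) = 0"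
      by (rule ballI)
    then have xz: "\<forall>j\<in>I. x $ ?p j = 0"
      by (rule mp[OF spec[OF inj]])
    have "x $ b = 0" if "b < card I" for b
      using xz p that unfolding bij_betw_def by (metis (mono_tags, lifting) image_iff lessThan_iff)
    then show False
      using x(1,2) by (auto simp: vec_eq_iff)
  qed
  with K show ?thesis
    by (rule that)
qed

text \<open>The inverse of the minor is its adjugate times the inverse \<open>e\<close> of the
  determinant. Its rows, extended by zero to the rows of \<open>G\<close> outside \<open>K\<close>,
  are the coefficients of the dual rows. Asking for a unit covers fields and the integers at
  once.\<close>

lemma dual_rows_if_unit_minor:
  fixes G :: "'r::comm_ring_1 mat"
  assumes K: "K \<subseteq> {..<dim_row G}" and I: "I \<subseteq> col_set G" and card: "card K = card I"
    and unit: "det (submatrix G K I) dvd 1"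
  shows "\<exists>c. dual_rows G I c"
proof -
  have finI: "finite I" and finK: "finite K"
    using I K finite_subset by blast+
  let ?p = "\<lambda>i. card {a \<in> I. a < i}"
  let ?r = "\<lambda>k. card {a \<in> K. a < k}"
  let ?M = "submatrix G K I"
  have M: "?M \<in> carrier_mat (card I) (card I)"
    using submatrix_carrier[OF K I] card by simp
  have p: "bij_betw ?p I {..<card I}" and r: "bij_betw ?r K {..<card I}"
    using bij_betw_card_less[OF finI] bij_betw_card_less[OF finK] card by simp_all
  obtain e where e: "1 = det ?M * e"
    using unit by (rule dvdE)
  define c where "c i k = (if k \<in> K then e * adj_mat ?M $$ (?p i, ?r k) else 0)" for i k
  have "expansion_coeff G c i j = (if i = j then 1 else 0)" if ij: "i \<in> I" "j \<in> I" for i j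
  proof -
    have pij: "?p i < card I" "?p j < card I"
      using bij_betw_apply[OF p] ij by auto
    have "expansion_coeff G c i j = (\<Sum>k\<in>K. e * adj_mat ?M $$ (?p i, ?r k) * G $$ (k, j))"
      unfolding expansion_coeff_def using K
      by (intro sum.mono_neutral_cong_right) (auto simp: c_def)
    also have "\<dots> = (\<Sum>k\<in>K. e * (adj_mat ?M $$ (?p i, ?r k) * ?M $$ (?r k, ?p j)))"
    proof (intro sum.cong refl)
      fix k assume "k \<in> K"
      then show "e * adj_mat ?M $$ (?p i, ?r k) * G $$ (k, j) = e * (adj_mat ?M $$ (?p i, ?r k) * ?M $$ (?r k, ?p j))"
        using submatrix_index_card[of k G j K I] K I ij(2) by (simp add: subset_iff mult.assoc)
    qed
    also have "\<dots> = (\<Sum>b<card I. e * (adj_mat ?M $$ (?p i, b) * ?M $$ (b, ?p j)))"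
      using sum.reindex_bij_betw[OF r] .
    also have "\<dots> = e * (adj_mat ?M * ?M) $$ (?p i, ?p j)"
      using pij M adj_mat(1)[OF M]
      by (simp add: scalar_prod_def lessThan_atLeast0 sum_distrib_left)
    also have "\<dots> = (if ?p i = ?p j then 1 else 0)"
      using pij e by (simp add: adj_mat(3)[OF M] mult.commute)
    also have "?p i = ?p j \<longleftrightarrow> i = j"
      using bij_betw_imp_inj_on[OF p] ij by (auto dest: inj_onD)
    finally show ?thesis .
  qed
  then show ?thesis
    unfolding dual_rows_def by blast
qed

lemma unimodular_mat_field: "unimodular_mat (G :: 'k::field mat)"
  unfolding unimodular_mat_def
proof (intro allI impI)
  fix I assume I: "I \<subseteq> col_set G" "independent_cols G I"
  then obtain K where "K \<subseteq> {..<dim_row G}" "card K = card I" "det (submatrix G K I) \<noteq> 0"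
    by (rule ex_nonzero_minor)
  then show "\<exists>c. dual_rows G I c"
    using I(1) by (intro dual_rows_if_unit_minor) (simp_all add: dvd_field_iff)
qed

text \<open>Independence over the rationals yields a nonzero minor, and total unimodularity leaves
  only the units 1 and -1 for it.\<close>

lemma unimodular_mat_if_totally_unimodular:
  assumes "totally_unimodular G"
  shows "unimodular_mat G"
  unfolding unimodular_mat_def
proof (intro allI impI)
  fix I assume I: "I \<subseteq> col_set G" "independent_cols G I"
  then have "independent_cols (map_mat rat_of_int G) I" "I \<subseteq> col_set (map_mat rat_of_int G)"
    by (simp_all add: independent_cols_of_int_iff)
  then obtain K where K: "K \<subseteq> {..<dim_row G}" "card K = card I"
    and det: "det (submatrix (map_mat rat_of_int G) K I) \<noteq> 0"
    using ex_nonzero_minor[of I "map_mat rat_of_int G"] by auto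
  have "submatrix (map_mat rat_of_int G) K I = map_mat rat_of_int (submatrix G K I)"
    by (rule eq_matI) (auto simp: submatrix_def pick_le)
  then have "det (submatrix G K I) \<noteq> 0"
    using det by (simp add: of_int_hom.hom_det)
  moreover have "det (submatrix G K I) \<in> {-1, 0, 1}"
    using assms K I(1) unfolding totally_unimodular_def by blast
  ultimately have "det (submatrix G K I) dvd 1"
    by auto
  then show "\<exists>c. dual_rows G I c"
    using K I(1) by (intro dual_rows_if_unit_minor)
qed

section \<open>Abelian groups and coordinate spaces as modules\<close>

lemma int_scale_add_one: "int_scale (n + 1) a = int_scale n a + a"
proof (cases "n \<ge> 0")
  case True
  then have "nat (n + 1) = Suc (nat n)" "nat (- n) = 0" "nat (- (n + 1)) = 0"
    by auto
  then show ?thesis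
    by (simp add: int_scale_def add.commute)
next
  case False
  then have "nat (- n) = Suc (nat (- (n + 1)))" "nat n = 0" "nat (n + 1) = 0"
    by auto
  then show ?thesis
    by (simp add: int_scale_def)
qed

lemma int_scale_diff_one: "int_scale (n - 1) a = int_scale n a - a"
  using int_scale_add_one[of "n - 1" a] by simp

lemma module_int_scale: "Modules.module (int_scale :: int \<Rightarrow> 'a::ab_group_add \<Rightarrow> 'a)"
proof
  fix m n :: int and x y :: 'a
  have zero: "int_scale 0 z = 0" for z :: 'a
    by (simp add: int_scale_def)
  show right: "int_scale m (x + y) = int_scale m x + int_scale m y" for m and x y :: 'a
    by (induction m rule: int_induct[where k = 0])
      (simp_all add: zero int_scale_add_one int_scale_diff_one)
  show left: "int_scale (m + n) x = int_scale m x + int_scale n x" for m n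
  proof (induction m rule: int_induct[where k = 0])
    case (step1 m)
    then show ?case
      using int_scale_add_one[of "m + n" x] int_scale_add_one[of m x] by (simp add: ac_simps)
  next
    case (step2 m)
    have "m - 1 + n = m + n - 1"
      by simp
    then show ?case
      using step2 by (simp only: int_scale_diff_one) simp
  qed (simp add: zero)
  have neg: "int_scale (- n) z = - int_scale n z" for n and z :: 'a
    by (simp add: int_scale_def)
  show "int_scale m (int_scale n x) = int_scale (m * n) x"
  proof (induction m rule: int_induct[where k = 0])
    case (step1 m)
    then show ?case
      by (simp add: int_scale_add_one distrib_right left)
  next
    case (step2 m)
    have "(m - 1) * n = m * n + - n"
      by (simp add: algebra_simps)
    then have "int_scale ((m - 1) * n) x = int_scale (m * n) x + int_scale (- n) x"
      by (simp only: left)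
    then show ?case
      using step2 by (simp add: int_scale_diff_one neg)
  qed (simp add: zero)
  show "int_scale 1 x = x"
    by (simp add: int_scale_def)
qed

lemma finite_module_int_scale: "finite_module (int_scale :: int \<Rightarrow> 'a::{ab_group_add, finite} \<Rightarrow> 'a)"
  unfolding finite_module_def by (rule module_int_scale)

lemma finite_module_vec: "finite_module ((*s) :: 'k::{field, finite} \<Rightarrow> 'k ^ 'd \<Rightarrow> 'k ^ 'd)"
  unfolding finite_module_def
  by unfold_locales (simp_all add: Finite_Cartesian_Product.vec_eq_iff vector_scalar_mult_def algebra_simps)

section \<open>Agreement of the two descriptions of a flow\<close>

lemma orthogonal_rows:
  assumes "dim_col H = dim_col G" "H * transpose_mat G = 0\<^sub>m (dim_row H) (dim_row G)"
    and "k < dim_row H" "l < dim_row G"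
  shows "(\<Sum>j<dim_col G. H $$ (k, j) * G $$ (l, j)) = 0"
proof -
  have "(H * transpose_mat G) $$ (k, l) = (\<Sum>j<dim_col G. H $$ (k, j) * G $$ (l, j))"
    using assms(1,3,4) by (simp add: scalar_prod_def lessThan_atLeast0)
  then show ?thesis
    using assms by simp
qed

lemma int_flow_set_eq:
  fixes F :: "(nat \<Rightarrow> 'a::{ab_group_add, finite}) set"
  assumes uni: "unimodular_mat G" and F: "int_flow_set G F"
  shows "F = row_combinations int_scale G"
proof -
  interpret finite_module "int_scale :: int \<Rightarrow> 'a \<Rightarrow> 'a"
    by (rule finite_module_int_scale)
  have "kernel_flows int_scale H = (row_combinations int_scale G :: (nat \<Rightarrow> 'a) set)"
    if H: "int_orthogonally_dual G H" for H
  proof (rule kernel_flows_eq_row_combinations_if_integral[OF _ _ _ uni])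
    let ?r = "map_mat rat_of_int"
    have dual: "dim_col (?r H) = dim_col (?r G)"
      "?r H * transpose_mat (?r G) = 0\<^sub>m (dim_row (?r H)) (dim_row (?r G))"
      using H by (auto simp: int_orthogonally_dual_def orthogonally_dual_def)
    show dim: "dim_col H = dim_col G"
      using dual(1) by simp
    show "(\<Sum>j<dim_col G. H $$ (k, j) * G $$ (l, j)) = 0" if "k < dim_row H" "l < dim_row G" for k l
    proof -
      have "rat_of_int (\<Sum>j<dim_col G. H $$ (k, j) * G $$ (l, j)) = 0"
        using orthogonal_rows[OF dual, of k l] that dim by simp
      then show ?thesis
        by (simp only: of_int_eq_0_iff)
    qed
    \<comment> \<open>The second clause of integral duality enters here: an integer vector
      orthogonal to the rows of \<open>G\<close> is an integral, not just a rational, combination of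
      the rows of \<open>H\<close>.\<close>
    fix x assume x: "\<And>l. l < dim_row G \<Longrightarrow> (\<Sum>j<dim_col G. G $$ (l, j) * x j) = 0"
    then have "G *\<^sub>v vec (dim_col G) x = 0\<^sub>v (dim_row G)"
      by (auto simp: vec_eq_iff scalar_prod_def lessThan_atLeast0)
    then obtain d where d: "d \<in> carrier_vec (dim_row H)" "vec (dim_col G) x = transpose_mat H *\<^sub>v d"
      using H unfolding int_orthogonally_dual_def by (metis vec_carrier)
    have "x j = (\<Sum>k<dim_row H. H $$ (k, j) * d $ k)" if "j < dim_col G" for j
    proof -
      have "x j = (transpose_mat H *\<^sub>v d) $ j"
        using that d(2)[symmetric] by simp
      then show ?thesis
        using that dim d(1) by (simp add: scalar_prod_def lessThan_atLeast0)
    qed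
    then show "\<exists>d. \<forall>j<dim_col G. x j = (\<Sum>k<dim_row H. H $$ (k, j) * d k)"
      by (intro exI[of _ "\<lambda>k. d $ k"]) simp
  qed
  then show ?thesis
    using F by (auto simp: int_flow_set_def)
qed

lemma field_flow_set_eq:
  fixes F :: "(nat \<Rightarrow> 'k::{field, finite} ^ 'd) set"
  assumes F: "field_flow_set G F"
  shows "F = row_combinations (*s) G"
proof -
  interpret finite_module "(*s) :: 'k \<Rightarrow> 'k ^ 'd \<Rightarrow> 'k ^ 'd"
    by (rule finite_module_vec)
  have "kernel_flows (*s) H = (row_combinations (*s) G :: (nat \<Rightarrow> 'k ^ 'd) set)"
    if "orthogonally_dual G H" for H
    using that orthogonal_rows unfolding orthogonally_dual_def
    by (intro kernel_flows_eq_row_combinations_if_ranks_add unimodular_mat_field)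
      (auto simp: mat_rank_eq_col_rk)
  then show ?thesis
    using F by (auto simp: field_flow_set_def)
qed

section \<open>Graphs\<close>

definition undirected_steps :: "('v, 'e) pre_digraph \<Rightarrow> 'e set \<Rightarrow> ('v \<times> 'v) set" where
  "undirected_steps D A = (\<Union>e\<in>A. {(tail D e, head D e), (head D e, tail D e)})"

lemma undirected_component_closed:
  assumes "e \<in> A"
  shows "head D e \<in> (undirected_steps D A)\<^sup>* `` {u} \<longleftrightarrow> tail D e \<in> (undirected_steps D A)\<^sup>* `` {u}"
  using assms by (auto simp: undirected_steps_def intro: rtrancl_into_rtrancl)

text \<open>
  The dual row of an edge \<open>i\<close> of a forest \<open>I\<close> is the cut around one side of \<open>I - {i}\<close>.
\<close>

lemma unimodular_mat_vertex_edge: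
  assumes D: "wf_digraph D" and G: "vertex_edge_matrix D G"
  shows "unimodular_mat G"
proof (rule unimodular_matI)
  interpret wf_digraph D by (rule D)
  fix I i assume I: "I \<subseteq> col_set G" and indep: "independent_cols G I" and i: "i \<in> I"
  obtain vs es where vs: "distinct vs" "set vs = verts D" and es: "distinct es" "set es = arcs D"
    and G: "G = mat (length vs) (length es) (\<lambda>(i, j).
              (if head D (es ! j) = vs ! i then 1 else 0)
            - (if tail D (es ! j) = vs ! i then 1 else 0))"
    using G unfolding vertex_edge_matrix_def by blast
  have I_es: "j < length es" if "j \<in> I" for j
    using that I by (auto simp: G)
  have finI: "finite I"
    using I finite_subset by blast
  have entry: "G $$ (k, j) = (if head D (es ! j) = vs ! k then 1 else 0) - (if tail D (es ! j) = vs ! k then 1 else 0)"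
    if "k < length vs" "j \<in> I" for k j
    using that I_es by (simp add: G)
  \<comment> \<open>Weighting the vertex rows by a potential \<open>f\<close> gives at each edge the
    difference of its end values; an indicator function gives the signed row of a cut.\<close>
  have cut: "(\<Sum>k<dim_row G. f (vs ! k) * G $$ (k, j)) = f (head D (es ! j)) - f (tail D (es ! j))"
    if j: "j \<in> I" for f j
  proof -
    have "es ! j \<in> arcs D"
      using es(2) I_es[OF j] nth_mem by blast
    then have ends: "head D (es ! j) \<in> set vs" "tail D (es ! j) \<in> set vs"
      using vs(2) by simp_all
    have "(\<Sum>k<dim_row G. f (vs ! k) * G $$ (k, j)) = (\<Sum>k<length vs.
        (if head D (es ! j) = vs ! k then f (vs ! k) else 0) - (if tail D (es ! j) = vs ! k then f (vs ! k) else 0))"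
    proof (rule sum.cong)
      fix k assume "k \<in> {..<length vs}"
      then show "f (vs ! k) * G $$ (k, j) =
          (if head D (es ! j) = vs ! k then f (vs ! k) else 0) - (if tail D (es ! j) = vs ! k then f (vs ! k) else 0)"
        using entry[of k j] j by simp
    qed (simp add: G)
    also have "\<dots> = (\<Sum>v\<in>set vs. (if head D (es ! j) = v then f v else 0) - (if tail D (es ! j) = v then f v else 0))"
      using sum.reindex_bij_betw[OF bij_betw_nth[OF vs(1) refl refl]] .
    finally show ?thesis
      using ends by (simp add: sum_subtractf)
  qed
  define A where "A = (\<lambda>j. es ! j) ` (I - {i})"
  define S where "S = (undirected_steps D A)\<^sup>* `` {head D (es ! i)}"
  \<comment> \<open>A walk from the head of edge \<open>i\<close> to \<open>v\<close> inside
    \<open>I - {i}\<close> expresses the difference of the two vertex unit vectors through columns: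
    the signed columns along the walk telescope.\<close>
  have "\<exists>x. \<forall>k<dim_row G. (\<Sum>j\<in>I - {i}. x j * G $$ (k, j)) =
      (if v = vs ! k then 1 else 0) - (if head D (es ! i) = vs ! k then 1 else 0)"
    if "(head D (es ! i), v) \<in> (undirected_steps D A)\<^sup>*" for v
    using that
  proof (induction rule: rtrancl_induct)
    case base
    show ?case
      by (intro exI[of _ "\<lambda>_. 0"]) simp
  next
    case (step v w)
    obtain x where x: "\<forall>k<dim_row G. (\<Sum>j\<in>I - {i}. x j * G $$ (k, j)) =
        (if v = vs ! k then 1 else 0) - (if head D (es ! i) = vs ! k then 1 else 0)"
      using step.IH by blast
    obtain l s where l: "l \<in> I - {i}"
      and s: "s = 1 \<and> v = tail D (es ! l) \<and> w = head D (es ! l) \<or>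
              s = (-1 :: int) \<and> v = head D (es ! l) \<and> w = tail D (es ! l)"
      using step.hyps(2) by (auto simp: undirected_steps_def A_def)
    have "(\<Sum>j\<in>I - {i}. (x j + (if j = l then s else 0)) * G $$ (k, j)) =
        (if w = vs ! k then 1 else 0) - (if head D (es ! i) = vs ! k then 1 else 0)"
      if k: "k < dim_row G" for k
    proof -
      have "(\<Sum>j\<in>I - {i}. (x j + (if j = l then s else 0)) * G $$ (k, j))
          = (\<Sum>j\<in>I - {i}. x j * G $$ (k, j) + (if j = l then s * G $$ (k, j) else 0))"
        by (intro sum.cong) (auto simp: distrib_right)
      also have "\<dots> = (if v = vs ! k then 1 else 0) - (if head D (es ! i) = vs ! k then 1 else 0) + s * G $$ (k, l)"
        using x k l finI by (simp add: sum.distrib)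
      finally show ?thesis
        using entry[of k l] k l s by (auto simp: G)
    qed
    then show ?case
      by (intro exI[of _ "\<lambda>j. x j + (if j = l then s else 0)"]) simp
  qed
  then have path: "\<exists>x. \<forall>k<dim_row G. (\<Sum>j\<in>I - {i}. x j * G $$ (k, j)) =
      (if v = vs ! k then 1 else 0) - (if head D (es ! i) = vs ! k then 1 else 0)" if "v \<in> S" for v
    using that by (simp add: S_def)
  have tail: "tail D (es ! i) \<notin> S"
  proof
    assume "tail D (es ! i) \<in> S"
    then obtain x where x: "\<forall>k<dim_row G. (\<Sum>j\<in>I - {i}. x j * G $$ (k, j)) =
        (if tail D (es ! i) = vs ! k then 1 else 0) - (if head D (es ! i) = vs ! k then 1 else 0)"
      using path by blast
    \<comment> \<open>Edge \<open>i\<close> would close such a walk inside \<open>I\<close>, and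
      this is a dependence with coefficient 1 at \<open>i\<close>.\<close>
    have "(\<Sum>j\<in>I. (if j = i then 1 else x j) * G $$ (k, j)) = 0" if k: "k < dim_row G" for k
    proof -
      have "(\<Sum>j\<in>I. (if j = i then 1 else x j) * G $$ (k, j)) = G $$ (k, i) + (\<Sum>j\<in>I - {i}. x j * G $$ (k, j))"
        using i finI by (simp add: sum.remove)
      then show ?thesis
        using x k entry[of k i] i by (simp add: G)
    qed
    then have "(if i = i then 1 else x i) = 0"
      using i by (rule independent_colsD[OF indep])
    then show False
      by simp
  qed
  \<comment> \<open>\<open>S\<close> contains the head but not the tail of edge \<open>i\<close>,
    and no other edge of \<open>I\<close> crosses its boundary.\<close>
  let ?f = "\<lambda>v. if v \<in> S then 1 else 0 :: int"
  have "?f (head D (es ! j)) - ?f (tail D (es ! j)) = (if i = j then 1 else 0)" if j: "j \<in> I" for j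
  proof (cases "i = j")
    case True
    then show ?thesis
      using tail by (auto simp: S_def)
  next
    case False
    then have "es ! j \<in> A"
      using j by (auto simp: A_def)
    then have "head D (es ! j) \<in> S \<longleftrightarrow> tail D (es ! j) \<in> S"
      unfolding S_def by (rule undirected_component_closed)
    then show ?thesis
      using False by simp
  qed
  then have "\<forall>j\<in>I. (\<Sum>k<dim_row G. ?f (vs ! k) * G $$ (k, j)) = (if i = j then 1 else 0)"
    using cut[of _ ?f] by simp
  then show "\<exists>c. \<forall>j\<in>I. (\<Sum>k<dim_row G. c k * G $$ (k, j)) = (if i = j then 1 else 0)"
    by (intro exI[of _ "\<lambda>k. ?f (vs ! k)"])
qed

section \<open>Walks and cycles in the underlying undirected graph\<close>

lemma both_ways_simps:
  "verts (both_ways D) = verts D" "arcs (both_ways D) = arcs D \<times> UNIV"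
  "tail (both_ways D) (e, s) = (if s then tail D e else head D e)"
  "head (both_ways D) (e, s) = (if s then head D e else tail D e)"
  by (simp_all add: both_ways_def)

lemma wf_both_ways:
  assumes "wf_digraph D"
  shows "wf_digraph (both_ways D)"
proof -
  interpret wf_digraph D by (rule assms)
  show ?thesis
    by unfold_locales (auto simp: both_ways_simps)
qed

text \<open>Every traversal contributes the potential at its end minus that at its start, whatever
  the reference orientation, and the sum telescopes.\<close>

lemma cas_potential_sum:
  fixes \<phi> :: "'v \<Rightarrow> int"
  assumes "pre_digraph.cas (both_ways D) u p w"
  shows "(\<Sum>(e, s)\<leftarrow>p. (if s then 1 else -1) * (\<phi> (head D e) - \<phi> (tail D e))) = \<phi> w - \<phi> u"
  using assms
proof (induction p arbitrary: u)
  case Nil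
  then show ?case
    by (simp add: pre_digraph.cas.simps)
next
  case (Cons a p)
  obtain e s where a: "a = (e, s)"
    by fastforce
  have "tail (both_ways D) a = u" "pre_digraph.cas (both_ways D) (head (both_ways D) a) p w"
    using Cons.prems by (simp_all add: pre_digraph.cas.simps)
  then show ?case
    using Cons.IH[of "head (both_ways D) a"] by (auto simp: a both_ways_simps)
qed

text \<open>If the first edge were used again, in either direction, one end of the later traversal
  would be the initial vertex, which a path does not revisit.\<close>

lemma apath_distinct_edges:
  assumes D: "wf_digraph D" and p: "pre_digraph.apath (both_ways D) u p w"
  shows "distinct (map fst p)"
  using p
proof (induction p arbitrary: u)
  case (Cons a p)
  interpret B: wf_digraph "both_ways D"
    using D by (rule wf_both_ways)
  have a: "tail (both_ways D) a = u" "B.apath (head (both_ways D) a) p w"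
    "u \<notin> set (B.awalk_verts (head (both_ways D) a) p)"
    using Cons.prems by (auto simp: B.apath_Cons_iff)
  have "fst a \<notin> fst ` set p"
  proof
    assume "fst a \<in> fst ` set p"
    then obtain b where b: "b \<in> set p" "fst b = fst a"
      by (metis imageE)
    have "tail (both_ways D) b \<in> set (B.awalk_verts (head (both_ways D) a) p)"
      using b(1) by (auto simp: B.awalk_verts_conv)
    moreover have "head (both_ways D) b \<in> set (B.awalk_verts (head (both_ways D) a) p)"
    proof -
      have "B.cas (head (both_ways D) a) p w"
        using a(2) by (auto simp: B.apath_def B.awalk_def)
      then show ?thesis
        using b(1) by (auto simp: B.awalk_verts_conv')
    qed
    moreover have "u = tail (both_ways D) b \<or> u = head (both_ways D) b"
      using a(1) b(2) by (cases a; cases b) (simp add: both_ways_simps split: if_splits)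
    ultimately show False
      using a(3) by auto
  qed
  then show ?case
    using Cons.IH[OF a(2)] by simp
qed simp

lemma undirected_reachable_awalk:
  assumes D: "wf_digraph D" and A: "A \<subseteq> arcs D" and w: "w \<in> verts D"
    and "(u, w) \<in> (undirected_steps D A)\<^sup>*"
  shows "\<exists>p. pre_digraph.awalk (both_ways D) u p w \<and> fst ` set p \<subseteq> A"
proof -
  interpret B: wf_digraph "both_ways D"
    using D by (rule wf_both_ways)
  show ?thesis
    using assms(4)
  proof (induction rule: converse_rtrancl_induct)
    case base
    have "B.awalk w [] w"
      using w by (simp add: B.awalk_Nil_iff both_ways_simps)
    then show ?case
      by (intro exI[of _ "[]"]) simp
  next
    case (step u v)
    obtain p where p: "B.awalk v p w" "fst ` set p \<subseteq> A"
      using step.IH by blast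
    obtain e s where e: "e \<in> A" "tail (both_ways D) (e, s) = u" "head (both_ways D) (e, s) = v"
    proof -
      obtain e where "e \<in> A" "u = tail D e \<and> v = head D e \<or> u = head D e \<and> v = tail D e"
        using step.hyps(1) by (auto simp: undirected_steps_def)
      then show ?thesis
        using that[of e True] that[of e False] by (auto simp: both_ways_simps)
    qed
    then have "B.awalk u ((e, s) # p) w"
      using p(1) A by (auto simp: B.awalk_Cons_iff both_ways_simps)
    then show ?case
      using p(2) e(1) by (intro exI[of _ "(e, s) # p"]) simp
  qed
qed

text \<open>Edge \<open>e\<close> is closed up by a path inside \<open>A\<close> from its head to
  its tail; since \<open>e\<close> is not in \<open>A\<close>, no edge repeats. For a loop this path
  is empty.\<close>

lemma ex_graph_cycle_through:
  assumes D: "wf_digraph D" and A: "A \<subseteq> arcs D" and e: "e \<in> arcs D" "e \<notin> A"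
    and conn: "(head D e, tail D e) \<in> (undirected_steps D A)\<^sup>*"
  shows "\<exists>c. graph_cycle D c \<and> e \<in> fst ` set c \<and> fst ` set c \<subseteq> insert e A"
proof -
  interpret wf_digraph D by (rule D)
  interpret B: wf_digraph "both_ways D"
    using D by (rule wf_both_ways)
  obtain p' where p': "B.awalk (head D e) p' (tail D e)" "fst ` set p' \<subseteq> A"
    using undirected_reachable_awalk[OF D A _ conn] e(1) by auto
  define p where "p = B.awalk_to_apath p'"
  have p: "B.apath (head D e) p (tail D e)" "fst ` set p \<subseteq> A"
    using B.apath_awalk_to_apath[OF p'(1)] B.awalk_to_apath_subset[OF p'(1)] p'(2)
    by (auto simp: p_def)
  let ?c = "(e, True) # p"
  have "B.awalk (tail D e) ?c (tail D e)"
    using p(1) e(1) by (simp add: B.awalk_Cons_iff B.apath_def) (simp add: both_ways_simps)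
  moreover have "distinct (tl (B.awalk_verts (tail D e) ?c))"
    using p(1) by (simp add: B.apath_def) (simp add: both_ways_simps)
  ultimately have "B.cycle ?c"
    unfolding B.cycle_def by blast
  moreover have "distinct (map fst ?c)"
    using apath_distinct_edges[OF D p(1)] p(2) e(2) by auto
  ultimately have "graph_cycle D ?c"
    by (simp add: graph_cycle_def)
  then show ?thesis
    using p(2) by (intro exI[of _ ?c]) auto
qed

text \<open>Since the edges of a cycle are distinct, its row records exactly the signed steps of a
  closed walk, along which potential differences telescope to zero. This is the orthogonality of
  cycles and cuts.\<close>

lemma sum_cycle_potential:
  fixes \<phi> :: "'v \<Rightarrow> int"
  assumes c: "graph_cycle D c" and es: "distinct es" "set es = arcs D"
  shows "(\<Sum>j<length es. (\<phi> (head D (es ! j)) - \<phi> (tail D (es ! j))) *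
    (if (es ! j, True) \<in> set c then 1 else if (es ! j, False) \<in> set c then -1 else 0)) = 0"
proof -
  let ?x = "\<lambda>e. \<phi> (head D e) - \<phi> (tail D e)"
  let ?s = "\<lambda>e. if (e, True) \<in> set c then 1 else if (e, False) \<in> set c then -1 else 0 :: int"
  obtain u where u: "pre_digraph.awalk (both_ways D) u c u"
    using c by (auto simp: graph_cycle_def pre_digraph.cycle_def)
  have dist: "distinct c" and inj: "inj_on fst (set c)"
    using c by (auto simp: graph_cycle_def distinct_map)
  have sub: "fst ` set c \<subseteq> arcs D"
    using u by (auto simp: pre_digraph.awalk_def both_ways_simps)
  have "(\<Sum>j<length es. ?x (es ! j) * ?s (es ! j)) = (\<Sum>e\<in>arcs D. ?x e * ?s e)"
    using sum.reindex_bij_betw[OF bij_betw_nth[OF es(1) refl es(2)[symmetric]], of "\<lambda>e. ?x e * ?s e"] .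
  also have "\<dots> = (\<Sum>e\<in>fst ` set c. ?x e * ?s e)"
  proof (rule sum.mono_neutral_right)
    show "finite (arcs D)"
      unfolding es(2)[symmetric] by simp
    have "(e, s) \<notin> set c" if "e \<notin> fst ` set c" for e s
      using that by force
    then show "\<forall>e\<in>arcs D - fst ` set c. ?x e * ?s e = 0"
      by simp
  qed (rule sub)
  also have "\<dots> = (\<Sum>a\<in>set c. ?x (fst a) * ?s (fst a))"
    by (simp add: sum.reindex[OF inj])
  also have "\<dots> = (\<Sum>(e, s)\<in>set c. (if s then 1 else -1) * ?x e)"
  proof (rule sum.cong)
    fix a assume a: "a \<in> set c"
    obtain e s where es: "a = (e, s)"
      by fastforce
    \<comment> \<open>An edge does not occur in both directions, so the order of the two tests in
      the matrix entry is immaterial.\<close>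
    have "(e, \<not> s) \<notin> set c"
      using inj_onD[OF inj, of "(e, s)" "(e, \<not> s)"] a es by auto
    then show "?x (fst a) * ?s (fst a) = (case a of (e, s) \<Rightarrow> (if s then 1 else -1) * ?x e)"
      using a es by (cases s) auto
  qed simp
  also have "\<dots> = (\<Sum>(e, s)\<leftarrow>c. (if s then 1 else -1) * ?x e)"
    using dist by (simp add: sum_list_distinct_conv_sum_set)
  also have "\<dots> = 0"
    using u by (subst cas_potential_sum[of D u c u]) (auto simp: pre_digraph.awalk_def)
  finally show ?thesis .
qed

text \<open>
  The dual row of \<open>i \<in> I\<close> is a cycle through \<open>i\<close> with all other edges outside \<open>I\<close>.
  If there is none, then some cut contained in \<open>I\<close> contains \<open>i\<close>, and it is a dependence of the columns in \<open>I\<close>.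
\<close>

lemma unimodular_mat_cycle_edge:
  assumes D: "wf_digraph D" and G: "cycle_edge_matrix D G"
  shows "unimodular_mat G"
proof (rule unimodular_matI)
  interpret wf_digraph D by (rule D)
  fix I i assume I: "I \<subseteq> col_set G" and indep: "independent_cols G I" and i: "i \<in> I"
  obtain cs es where es: "distinct es" "set es = arcs D" and cs: "\<forall>c\<in>set cs. graph_cycle D c"
    and all: "(\<lambda>c. fst ` set c) ` set cs = {fst ` set c | c. graph_cycle D c}"
    and G: "G = mat (length cs) (length es) (\<lambda>(i, j).
              if (es ! j, True) \<in> set (cs ! i) then 1
              else if (es ! j, False) \<in> set (cs ! i) then -1 else 0)"
    using G unfolding cycle_edge_matrix_def by (elim exE conjE) (rule that)
  have I_es: "j < length es" if "j \<in> I" for j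
    using that I by (auto simp: G)
  define A where "A = (\<lambda>j. es ! j) ` ({..<length es} - I)"
  have A: "A \<subseteq> arcs D"
    unfolding A_def es(2)[symmetric] by (auto intro: nth_mem)
  have notA: "es ! j \<notin> A" if "j \<in> I" for j
    using that I_es[OF that] nth_eq_iff_index_eq[OF es(1)] by (auto simp: A_def)
  have ei: "es ! i \<in> arcs D"
    using es(2) I_es[OF i] nth_mem by blast
  define S where "S = (undirected_steps D A)\<^sup>* `` {head D (es ! i)}"
  have "tail D (es ! i) \<in> S"
  proof (rule ccontr)
    assume tail: "tail D (es ! i) \<notin> S"
    let ?f = "\<lambda>v. if v \<in> S then 1 else 0 :: int"
    \<comment> \<open>The signed cut around \<open>S\<close>. No edge outside \<open>I\<close>
      leaves the component \<open>S\<close>, so the cut lies in \<open>I\<close>.\<close>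
    define x where "x j = ?f (head D (es ! j)) - ?f (tail D (es ! j))" for j
    have x0: "x j = 0" if "j < length es" "j \<notin> I" for j
    proof -
      have "es ! j \<in> A"
        using that by (auto simp: A_def)
      then have "head D (es ! j) \<in> S \<longleftrightarrow> tail D (es ! j) \<in> S"
        unfolding S_def by (rule undirected_component_closed)
      then show ?thesis
        by (simp add: x_def)
    qed
    have "(\<Sum>j\<in>I. x j * G $$ (k, j)) = 0" if k: "k < dim_row G" for k
    proof -
      have "(\<Sum>j\<in>I. x j * G $$ (k, j)) = (\<Sum>j<length es. x j * G $$ (k, j))"
        using x0 I_es by (intro sum.mono_neutral_left) auto
      also have "\<dots> = (\<Sum>j<length es. x j *
          (if (es ! j, True) \<in> set (cs ! k) then 1 else if (es ! j, False) \<in> set (cs ! k) then -1 else 0))"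
        using k by (intro sum.cong) (simp_all add: G)
      also have "\<dots> = 0"
        unfolding x_def using k cs by (intro sum_cycle_potential es) (simp add: G)
      finally show ?thesis .
    qed
    then have "x i = 0"
      using i by (rule independent_colsD[OF indep])
    then show False
      using tail by (auto simp: x_def S_def)
  qed
  then obtain c where c: "graph_cycle D c" "es ! i \<in> fst ` set c" "fst ` set c \<subseteq> insert (es ! i) A"
    using ex_graph_cycle_through[OF D A ei notA[OF i]] by (auto simp: S_def)
  then have "fst ` set c \<in> (\<lambda>c. fst ` set c) ` set cs"
    unfolding all by blast
  \<comment> \<open>Only the edge set of \<open>c\<close> is sure to occur among the rows; the
    listed cycle may run in the other direction, so its entry at \<open>i\<close> is known only up
    to sign.\<close>
  then obtain c' where c': "c' \<in> set cs" "fst ` set c' = fst ` set c"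
    by auto
  then obtain r where r: "r < length cs" "fst ` set (cs ! r) = fst ` set c"
    by (auto simp: in_set_conv_nth)
  have Gi: "G $$ (r, i) = 1 \<or> G $$ (r, i) = -1"
  proof -
    obtain s where "(es ! i, s) \<in> set (cs ! r)"
      using c(2) unfolding r(2)[symmetric] by auto
    then show ?thesis
      using r(1) I_es[OF i] by (cases s) (auto simp: G)
  qed
  have Gj: "G $$ (r, j) = 0" if j: "j \<in> I" "j \<noteq> i" for j
  proof -
    have "es ! j \<noteq> es ! i"
      using j I_es i nth_eq_iff_index_eq[OF es(1)] by blast
    then have "es ! j \<notin> fst ` set (cs ! r)"
      using c(3) notA[OF j(1)] r(2) by auto
    then have "(es ! j, s) \<notin> set (cs ! r)" for s
      by force
    then show ?thesis
      using r(1) I_es[OF j(1)] by (simp add: G)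
  qed
  \<comment> \<open>Multiplying row \<open>r\<close> by its own entry at \<open>i\<close>, which is
    1 or -1, removes the sign.\<close>
  have "(\<Sum>k<dim_row G. (if k = r then G $$ (r, i) else 0) * G $$ (k, j)) = (if i = j then 1 else 0)" if j: "j \<in> I" for j
  proof -
    have "(\<Sum>k<dim_row G. (if k = r then G $$ (r, i) else 0) * G $$ (k, j))
        = (\<Sum>k<dim_row G. if k = r then G $$ (r, i) * G $$ (k, j) else 0)"
      by (intro sum.cong) auto
    also have "\<dots> = G $$ (r, i) * G $$ (r, j)"
      using r(1) by (simp add: G)
    finally show ?thesis
      using Gi Gj[OF j] by auto
  qed
  then show "\<exists>c. \<forall>j\<in>I. (\<Sum>k<dim_row G. c k * G $$ (k, j)) = (if i = j then 1 else 0)"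
    by (intro exI[of _ "\<lambda>k. if k = r then G $$ (r, i) else 0"]) simp
qed

section \<open>The identity\<close>

lemma rank_gen_poly_cong:
  assumes "\<And>B. B \<subseteq> E \<Longrightarrow> rk B = rk' B"
  shows "rank_gen_poly E rk l x = rank_gen_poly E rk' l x"
  unfolding rank_gen_poly_def using assms by (intro sum.cong) simp_all

lemma exp_power_eq_1:
  assumes "\<sigma> > 0" "\<theta> = 2 * real_of_int \<rho> * pi / real \<sigma>"
  shows "exp (\<i> * complex_of_real \<theta>) ^ \<sigma> = 1"
proof -
  have "exp (\<i> * complex_of_real \<theta>) ^ \<sigma> = cis (real \<sigma> * \<theta>)"
    by (simp add: cis_conv_exp[symmetric] DeMoivre)
  also have "real \<sigma> * \<theta> = 2 * pi * real_of_int \<rho>"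
    using assms by simp
  finally show ?thesis
    by (simp add: cis_multiple_2pi)
qed

theorem theorem4p7:
  fixes \<sigma> :: nat and \<rho> :: int and \<theta> :: real and \<omega> :: complex
    and D :: "('v, 'e) pre_digraph"
  assumes "\<sigma> > 1" and "coprime \<rho> (int \<sigma>)"
    and "\<theta> = 2 * real_of_int \<rho> * pi / real \<sigma>"
    and "\<omega> = exp (\<i> * complex_of_real \<theta>)"
  shows
    "(\<forall>(G :: int mat) (F :: (nat \<Rightarrow> 'a::{ab_group_add, finite}) set) r q.
        (fin_digraph D \<and> (vertex_edge_matrix D G \<or> cycle_edge_matrix D G)
          \<or> totally_unimodular G) \<and>
        int_flow_set G F \<and>
        r = mat_rank (map_mat rat_of_int G) \<and>
        q = CARD('a) \<and> q \<ge> 2 \<and>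
        \<not> (\<sigma> = 2 \<and> q = 4) \<and> \<not> (\<sigma> = 3 \<and> q = 3) \<and> \<not> (\<sigma> = 4 \<and> q = 2) \<longrightarrow>
        (\<Sum>k<\<sigma>. \<omega> ^ k * of_nat (card (pairs_M (col_set G) F k \<sigma>))) =
        complex_of_real
          ((2 - 2 * cos \<theta>) ^ r * (2 * cos \<theta> - 2 + real q) ^ (card (col_set G) - r) *
           rank_gen_poly (col_set G) (matroid_rk (map_mat rat_of_int G))
             (real q * (2 * cos \<theta> - 2 + real q) / (2 - 2 * cos \<theta>))
             ((2 - 2 * cos \<theta>) / (2 * cos \<theta> - 2 + real q))))
     \<and>
     (\<forall>(G :: 'k::{field, finite} mat) (F :: (nat \<Rightarrow> 'k ^ 'd) set) r q.
        field_flow_set G F \<and>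
        r = mat_rank G \<and>
        q = CARD('k ^ 'd) \<and> q \<ge> 2 \<and>
        \<not> (\<sigma> = 2 \<and> q = 4) \<and> \<not> (\<sigma> = 3 \<and> q = 3) \<and> \<not> (\<sigma> = 4 \<and> q = 2) \<longrightarrow>
        (\<Sum>k<\<sigma>. \<omega> ^ k * of_nat (card (pairs_M (col_set G) F k \<sigma>))) =
        complex_of_real
          ((2 - 2 * cos \<theta>) ^ r * (2 * cos \<theta> - 2 + real q) ^ (card (col_set G) - r) *
           rank_gen_poly (col_set G) (matroid_rk G)
             (real q * (2 * cos \<theta> - 2 + real q) / (2 - 2 * cos \<theta>))
             ((2 - 2 * cos \<theta>) / (2 * cos \<theta> - 2 + real q))))"
proof (intro conjI allI impI)
  have root: "exp (\<i> * complex_of_real \<theta>) ^ \<sigma> = 1"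
    using assms(1,3) by (intro exp_power_eq_1) simp_all
  {
    fix G :: "int mat" and F :: "(nat \<Rightarrow> 'a) set" and r q
    assume H: "(fin_digraph D \<and> (vertex_edge_matrix D G \<or> cycle_edge_matrix D G) \<or> totally_unimodular G) \<and>
        int_flow_set G F \<and> r = mat_rank (map_mat rat_of_int G) \<and> q = CARD('a) \<and> q \<ge> 2 \<and>
        \<not> (\<sigma> = 2 \<and> q = 4) \<and> \<not> (\<sigma> = 3 \<and> q = 3) \<and> \<not> (\<sigma> = 4 \<and> q = 2)"
    interpret finite_module "int_scale :: int \<Rightarrow> 'a \<Rightarrow> 'a"
      by (rule finite_module_int_scale)
    have uni: "unimodular_mat G"
      using H unimodular_mat_if_totally_unimodular unimodular_mat_vertex_edge[of D]
        unimodular_mat_cycle_edge[of D] fin_digraph.axioms(1)[of D] by blast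
    have F: "F = row_combinations int_scale G"
      using H by (intro int_flow_set_eq[OF uni]) simp
    have r: "r = col_rk G (col_set G)"
      using H mat_rank_eq_col_rk[of "map_mat rat_of_int G"] col_rk_of_int[of "col_set G" G] by simp
    have q: "q = CARD('a)" "q \<ge> 2"
      using H by simp_all
    \<comment> \<open>The statement takes the matroid over the rationals, the count uses
      independence over the integers; the ranks agree on every set of columns.\<close>
    have poly: "rank_gen_poly (col_set G) (matroid_rk (map_mat rat_of_int G)) = rank_gen_poly (col_set G) (col_rk G)"
      by (intro ext rank_gen_poly_cong) (simp add: matroid_rk_eq_col_rk col_rk_of_int)
    have nz: "2 - 2 * cos \<theta> \<noteq> 0" "2 * cos \<theta> - 2 + real q \<noteq> 0"
      using weights_nonzero(1)[OF assms(1-3)] weights_nonzero(2)[OF assms(1-3), of q] H by argo+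
    show "(\<Sum>k<\<sigma>. \<omega> ^ k * of_nat (card (pairs_M (col_set G) F k \<sigma>))) =
        complex_of_real
          ((2 - 2 * cos \<theta>) ^ r * (2 * cos \<theta> - 2 + real q) ^ (card (col_set G) - r) *
           rank_gen_poly (col_set G) (matroid_rk (map_mat rat_of_int G))
             (real q * (2 * cos \<theta> - 2 + real q) / (2 - 2 * cos \<theta>))
             ((2 - 2 * cos \<theta>) / (2 * cos \<theta> - 2 + real q)))"
      unfolding assms(4) F r poly q(1)
    proof (intro sum_pairs_M_row_combinations uni root)
      show "CARD('a) \<ge> 2" "2 * cos \<theta> - 2 + real CARD('a) \<noteq> 0"
        using q(2) nz(2) unfolding q(1) .
    qed (use nz(1) assms(1) in simp_all)
  }
  {
    fix G :: "'k mat" and F :: "(nat \<Rightarrow> 'k ^ 'd) set" and r q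
    assume H: "field_flow_set G F \<and> r = mat_rank G \<and> q = CARD('k ^ 'd) \<and> q \<ge> 2 \<and>
        \<not> (\<sigma> = 2 \<and> q = 4) \<and> \<not> (\<sigma> = 3 \<and> q = 3) \<and> \<not> (\<sigma> = 4 \<and> q = 2)"
    interpret finite_module "(*s) :: 'k \<Rightarrow> 'k ^ 'd \<Rightarrow> 'k ^ 'd"
      by (rule finite_module_vec)
    have F: "F = row_combinations (*s) G"
      using H by (intro field_flow_set_eq) simp
    have r: "r = col_rk G (col_set G)"
      using H by (simp add: mat_rank_eq_col_rk)
    have q: "q = CARD('k ^ 'd)" "q \<ge> 2"
      using H by blast+
    have nz: "2 - 2 * cos \<theta> \<noteq> 0" "2 * cos \<theta> - 2 + real q \<noteq> 0"
      using weights_nonzero(1)[OF assms(1-3)] weights_nonzero(2)[OF assms(1-3), of q] H by argo+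
    show "(\<Sum>k<\<sigma>. \<omega> ^ k * of_nat (card (pairs_M (col_set G) F k \<sigma>))) =
        complex_of_real
          ((2 - 2 * cos \<theta>) ^ r * (2 * cos \<theta> - 2 + real q) ^ (card (col_set G) - r) *
           rank_gen_poly (col_set G) (matroid_rk G)
             (real q * (2 * cos \<theta> - 2 + real q) / (2 - 2 * cos \<theta>))
             ((2 - 2 * cos \<theta>) / (2 * cos \<theta> - 2 + real q)))"
      unfolding assms(4) F r matroid_rk_eq_col_rk q(1)
    proof (intro sum_pairs_M_row_combinations unimodular_mat_field root)
      show "CARD('k ^ 'd) \<ge> 2" "2 * cos \<theta> - 2 + real CARD('k ^ 'd) \<noteq> 0"
        using q(2) nz(2) unfolding q(1) .
    qed (use nz(1) assms(1) in simp_all)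
  }
qed

end
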